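(* Let $H$ be a finite-dimensional Hopf algebra over $\Bbbk$, let $R$ be a finite-dimensional Hopf algebra in ${}^H_H\mathcal{YD}$, and let $A=R\#H$. Let $\mathcal J=\mathcal J^1\otimes\mathcal J^2\in R\otimes R$ be a braided twist for $R\in{}^H_H\mathcal{YD}$. Then $$\mathcal J\#1:=\mathcal J^1\#\mathcal J^2_{(-1)}\otimes\mathcal J^2_{(0)}\#1\in A\otimes A$$ is a twist for $A$. In particular, $R^{\mathcal J}\#H\simeq A^{\mathcal J\#1}$ as Hopf algebras. More generally, if $F=F^1\otimes F^2\in H\otimes H$ is a twist for $H$, then $$\mathcal J\#F:=F\,(\mathcal J\#1)=F^1_{(1)}\cdot\mathcal J^1\#F^1_{(2)}\mathcal J^2_{(-1)}\otimes F^2_{(1)}\cdot\mathcal J^2_{(0)}\#F^2_{(2)}$$ is a twist for $A$, and $(R^{\mathcal J}\#H)^F\simeq A^{\mathcal J\#F}$ as Hopf algebras.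
   Context: $\Bbbk$ is an algebraically closed field of characteristic zero; antipodes are assumed bijective; Sweedler notation is used for comultiplications and (left) coactions, with summation suppressed. Twist: for a Hopf algebra $K$, a twist is an invertible $J\in K\otimes K$ with $(1\otimes J)(\mathrm{id}\otimes\Delta)(J)=(J\otimes1)(\Delta\otimes\mathrm{id})(J)$ and $(\mathrm{id}\otimes\epsilon)(J)=(\epsilon\otimes\mathrm{id})(J)=1$. Then $K^J$ denotes the Hopf algebra with the algebra structure of $K$ and comultiplication $\Delta^J=J\Delta(\cdot)J^{-1}$. A twist for a Hopf subalgebra is a twist for the whole Hopf algebra. Yetter-Drinfeld setting: ${}^H_H\mathcal{YD}$ is the braided category of left-left Yetter-Drinfeld modules with braiding $c(v\otimes w)=v_{(-1)}\cdot w\otimes v_{(0)}$; $H$ acts on $R\otimes R$ diagonally and coacts by $\delta(r\otimes s)=r_{(-1)}s_{(-1)}\otimes r_{(0)}\otimes s_{(0)}$. The algebra $R\otimes R$ has product $(r\otimes s)(r'\otimes s')=r(s_{(-1)}\cdot r')\otimes s_{(0)}s'$. Bosonization: $R\#H$ is the vector space $R\otimes H$ with $(r\#h)(r'\#h')=r(h_{(1)}\cdot r')\#h_{(2)}h'$ and $\Delta(r\#h)=r_{(1)}\#r_{(2)(-1)}h_{(1)}\otimes r_{(2)(0)}\#h_{(2)}$. Braided twist: an invertible element $\mathcal J=\mathcal J^1\otimes\mathcal J^2\in R\otimes R$ (with the braided product above) such that $\delta(\mathcal J)=1\otimes\mathcal J$, $h\cdot\mathcal J=\epsilon(h)\mathcal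 J$ for all $h\in H$, $(\epsilon\otimes\mathrm{id})(\mathcal J)=(\mathrm{id}\otimes\epsilon)(\mathcal J)=1$, and, with $\mathrm J=\mathrm J^1\otimes\mathrm J^2$ another copy of $\mathcal J$, $$\mathcal J^1\otimes\mathrm J^1(\mathrm J^2_{(-1)}\cdot\mathcal J^2_{(1)})\otimes\mathrm J^2_{(0)}\mathcal J^2_{(2)}=\mathrm J^1(\mathrm J^2_{(-1)}\cdot\mathcal J^1_{(1)})\otimes\mathrm J^2_{(0)}\mathcal J^1_{(2)}\otimes\mathcal J^2.$$ $R^{\mathcal J}$ denotes the Hopf algebra in ${}^H_H\mathcal{YD}$ equal to $R$ as an algebra in ${}^H_H\mathcal{YD}$, with comultiplication $\Delta^{\mathcal J}(r)=\mathcal J\,\Delta_R(r)\,\mathcal J^{-1}$ computed in the braided algebra $R\otimes R$. *)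

theory Defs
  imports "HOL-Analysis.Cartesian_Space" "HOL-Computational_Algebra.Polynomial"
begin

section \<open>Finite-dimensional tensor calculus\<close>

text \<open>
  A finite-dimensional vector space over \<open>'k\<close> is given in coordinates with respect to a basis
  indexed by a finite type, i.e. as \<open>'k ^ 'n\<close>. The tensor product of \<open>'k ^ 'm\<close> and \<open>'k ^ 'n\<close> is
  then \<open>'k ^ ('m \<times> 'n)\<close>, with the Kronecker product as the universal bilinear map
  (lemmas \<open>sw_tensor\<close> and \<open>linear_eq_sw\<close> below). No Hopf structure is tied to the
  coordinates; in particular the componentwise product of \<open>'k ^ 'n\<close> is never used.
\<close>

abbreviation lin :: "(('k::field) ^ 'm \<Rightarrow> 'k ^ 'n) \<Rightarrow> bool" where
  "lin f \<equiv> Vector_Spaces.linear (*s) (*s) f"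

abbreviation lin_form :: "(('k::field) ^ 'm \<Rightarrow> 'k) \<Rightarrow> bool" where
  "lin_form f \<equiv> Vector_Spaces.linear (*s) (*) f"

definition bilin :: "(('k::field) ^ 'm \<Rightarrow> 'k ^ 'n \<Rightarrow> 'k ^ 'p) \<Rightarrow> bool" where
  "bilin b \<longleftrightarrow> (\<forall>x. lin (b x)) \<and> (\<forall>y. lin (\<lambda>x. b x y))"

definition tensor :: "('k::field) ^ 'm::finite \<Rightarrow> 'k ^ 'n::finite \<Rightarrow> 'k ^ ('m \<times> 'n)" (infixr "\<otimes>" 75) where
  "v \<otimes> w = (\<chi> p. v $ fst p * w $ snd p)"

text \<open>
  \<open>sw t b\<close> is the value at \<open>t\<close> of the linear map induced by the bilinear map \<open>b\<close>. It renders
  Sweedler notation: if \<open>t = t\<^sup>1 \<otimes> t\<^sup>2\<close> (summation suppressed), then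
  \<open>sw t (\<lambda>t1 t2. b t1 t2)\<close> is \<open>b(t\<^sup>1, t\<^sup>2)\<close>.
\<close>

definition sw :: "('k::field) ^ ('m::finite \<times> 'n::finite) \<Rightarrow> ('k ^ 'm \<Rightarrow> 'k ^ 'n \<Rightarrow> 'k ^ 'p) \<Rightarrow> 'k ^ 'p" where
  "sw t b = (\<Sum>p\<in>UNIV. t $ p *s b (axis (fst p) 1) (axis (snd p) 1))"

definition tmap :: "(('k::field) ^ 'm::finite \<Rightarrow> 'k ^ 'p::finite) \<Rightarrow> ('k ^ 'n::finite \<Rightarrow> 'k ^ 'q::finite)
    \<Rightarrow> 'k ^ ('m \<times> 'n) \<Rightarrow> 'k ^ ('p \<times> 'q)" where
  "tmap f g t = sw t (\<lambda>a b. f a \<otimes> g b)"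

definition tassoc :: "('k::field) ^ (('m::finite \<times> 'n::finite) \<times> 'p::finite) \<Rightarrow> 'k ^ ('m \<times> ('n \<times> 'p))" where
  "tassoc t = (\<chi> p. t $ ((fst p, fst (snd p)), snd (snd p)))"

lemma tassoc_tensor: "tassoc ((u \<otimes> v) \<otimes> w) = u \<otimes> (v \<otimes> w)"
  by (simp add: tassoc_def tensor_def vec_eq_iff mult.assoc)

lemma bilin_tensor: "bilin (\<otimes>)"
  by (auto simp: bilin_def Vector_Spaces.linear_iff vec.vector_space_axioms tensor_def vec_eq_iff
      algebra_simps)

lemma lin_sw: "lin (\<lambda>t. sw t b)"
  by (auto simp: Vector_Spaces.linear_iff vec.vector_space_axioms sw_def sum.distrib
      vec.scale_left_distrib vec.scale_sum_right)

lemma sw_tensor: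
  assumes "bilin b"
  shows "sw (v \<otimes> w) b = b v w"
proof -
  have 1: "lin (\<lambda>x. b x y)" and 2: "lin (b x)" for x y
    using assms by (auto simp: bilin_def)
  have "b v w = b (\<Sum>i\<in>UNIV. v $ i *s axis i 1) w"
    by (simp add: basis_expansion)
  also have "\<dots> = (\<Sum>i\<in>UNIV. v $ i *s b (axis i 1) (\<Sum>j\<in>UNIV. w $ j *s axis j 1))"
    unfolding vec.linear_sum[OF 1] vec.linear_scale[OF 1] by (simp add: basis_expansion)
  also have "\<dots> = (\<Sum>i\<in>UNIV. v $ i *s (\<Sum>j\<in>UNIV. w $ j *s b (axis i 1) (axis j 1)))"
    unfolding vec.linear_sum[OF 2] vec.linear_scale[OF 2] ..
  also have "\<dots> = sw (v \<otimes> w) b"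
    by (simp add: sw_def tensor_def vec.scale_sum_right sum.cartesian_product case_prod_beta)
  finally show ?thesis ..
qed

lemma axis_tensor: "axis i 1 \<otimes> axis j 1 = axis (i, j) 1"
  by (auto simp: tensor_def axis_def vec_eq_iff)

lemma linear_eq_sw:
  assumes "lin f"
  shows "f t = sw t (\<lambda>a b. f (a \<otimes> b))"
proof -
  have "f t = f (\<Sum>p\<in>UNIV. t $ p *s axis p 1)"
    by (simp add: basis_expansion)
  then show ?thesis
    by (simp add: sw_def axis_tensor vec.linear_sum[OF assms] vec.linear_scale[OF assms])
qed

section \<open>Hopf algebras\<close>

record ('k, 'n::finite) bialg =
  mul :: "'k ^ 'n \<Rightarrow> 'k ^ 'n \<Rightarrow> 'k ^ 'n"
  unit_el :: "'k ^ 'n"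
  comul :: "'k ^ 'n \<Rightarrow> 'k ^ ('n \<times> 'n)"
  counit :: "'k ^ 'n \<Rightarrow> 'k"

definition algebra_ax :: "(('k::field), 'n::finite, 'z) bialg_scheme \<Rightarrow> bool" where
  "algebra_ax K \<longleftrightarrow>
     bilin (mul K) \<and>
     (\<forall>x y z. mul K (mul K x y) z = mul K x (mul K y z)) \<and>
     (\<forall>x. mul K (unit_el K) x = x \<and> mul K x (unit_el K) = x)"

definition coalgebra_ax :: "(('k::field), 'n::finite, 'z) bialg_scheme \<Rightarrow> bool" where
  "coalgebra_ax K \<longleftrightarrow>
     lin (comul K) \<and> lin_form (counit K) \<and>
     (\<forall>x. tassoc (tmap (comul K) id (comul K x)) = tmap id (comul K) (comul K x)) \<and>
     (\<forall>x. sw (comul K x) (\<lambda>a b. counit K a *s b) = x \<and>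
          sw (comul K x) (\<lambda>a b. counit K b *s a) = x)"

definition tensor_mul :: "(('k::field) ^ 'm::finite \<Rightarrow> 'k ^ 'm \<Rightarrow> 'k ^ 'm) \<Rightarrow> ('k ^ 'n::finite \<Rightarrow> 'k ^ 'n \<Rightarrow> 'k ^ 'n)
    \<Rightarrow> 'k ^ ('m \<times> 'n) \<Rightarrow> 'k ^ ('m \<times> 'n) \<Rightarrow> 'k ^ ('m \<times> 'n)" where
  "tensor_mul m m' s t = sw s (\<lambda>a b. sw t (\<lambda>c d. m a c \<otimes> m' b d))"

definition bialgebra :: "(('k::field), 'n::finite, 'z) bialg_scheme \<Rightarrow> bool" where
  "bialgebra K \<longleftrightarrow>
     algebra_ax K \<and> coalgebra_ax K \<and>
     (\<forall>x y. comul K (mul K x y) = tensor_mul (mul K) (mul K) (comul K x) (comul K y)) \<and>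
     comul K (unit_el K) = unit_el K \<otimes> unit_el K \<and>
     (\<forall>x y. counit K (mul K x y) = counit K x * counit K y) \<and>
     counit K (unit_el K) = 1"

definition is_antipode :: "(('k::field), 'n::finite, 'z) bialg_scheme \<Rightarrow> ('k ^ 'n \<Rightarrow> 'k ^ 'n) \<Rightarrow> bool" where
  "is_antipode K S \<longleftrightarrow>
     lin S \<and>
     (\<forall>x. sw (comul K x) (\<lambda>a b. mul K (S a) b) = counit K x *s unit_el K \<and>
          sw (comul K x) (\<lambda>a b. mul K a (S b)) = counit K x *s unit_el K)"

text \<open>Antipodes are unique, so they are not part of the data; they are required to be bijective.\<close>

definition antipode :: "(('k::field), 'n::finite, 'z) bialg_scheme \<Rightarrow> 'k ^ 'n \<Rightarrow> 'k ^ 'n" where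
  "antipode K = (THE S. is_antipode K S)"

definition hopf_algebra :: "(('k::field), 'n::finite, 'z) bialg_scheme \<Rightarrow> bool" where
  "hopf_algebra K \<longleftrightarrow> bialgebra K \<and> (\<exists>S. is_antipode K S \<and> bij S)"

definition hopf_iso :: "(('k::field), 'm::finite) bialg \<Rightarrow> ('k, 'n::finite) bialg \<Rightarrow> bool" where
  "hopf_iso K L \<longleftrightarrow>
     hopf_algebra K \<and> hopf_algebra L \<and>
     (\<exists>f. lin f \<and> bij f \<and>
        (\<forall>x y. f (mul K x y) = mul L (f x) (f y)) \<and> f (unit_el K) = unit_el L \<and>
        (\<forall>x. comul L (f x) = tmap f f (comul K x)) \<and> (\<forall>x. counit L (f x) = counit K x))"

section \<open>Twists\<close>

definition invertible_in :: "('a \<Rightarrow> 'a \<Rightarrow> 'a) \<Rightarrow> 'a \<Rightarrow> 'a \<Rightarrow> bool" where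
  "invertible_in m e x \<longleftrightarrow> (\<exists>y. m x y = e \<and> m y x = e)"

definition inverse_in :: "('a \<Rightarrow> 'a \<Rightarrow> 'a) \<Rightarrow> 'a \<Rightarrow> 'a \<Rightarrow> 'a" where
  "inverse_in m e x = (THE y. m x y = e \<and> m y x = e)"

definition twist :: "(('k::field), 'n::finite, 'z) bialg_scheme \<Rightarrow> 'k ^ ('n \<times> 'n) \<Rightarrow> bool" where
  "twist K J \<longleftrightarrow>
     invertible_in (tensor_mul (mul K) (mul K)) (unit_el K \<otimes> unit_el K) J \<and>
     (let mul3 = tensor_mul (mul K) (tensor_mul (mul K) (mul K)) in
        mul3 (unit_el K \<otimes> J) (tmap id (comul K) J) =
        mul3 (tassoc (J \<otimes> unit_el K)) (tassoc (tmap (comul K) id J))) \<and>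
     sw J (\<lambda>a b. counit K b *s a) = unit_el K \<and>
     sw J (\<lambda>a b. counit K a *s b) = unit_el K"

definition twisted :: "(('k::field), 'n::finite) bialg \<Rightarrow> 'k ^ ('n \<times> 'n) \<Rightarrow> ('k, 'n) bialg" where
  "twisted K J = K\<lparr>comul := \<lambda>x.
     tensor_mul (mul K) (mul K) (tensor_mul (mul K) (mul K) J (comul K x))
       (inverse_in (tensor_mul (mul K) (mul K)) (unit_el K \<otimes> unit_el K) J)\<rparr>"

section \<open>Hopf algebras in the Yetter-Drinfeld category\<close>

record ('k, 'h::finite, 'n::finite) yd_bialg = "('k, 'n) bialg" +
  act :: "'k ^ 'h \<Rightarrow> 'k ^ 'n \<Rightarrow> 'k ^ 'n"
  coact :: "'k ^ 'n \<Rightarrow> 'k ^ ('h \<times> 'n)"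

definition yd_module :: "(('k::field), 'h::finite) bialg \<Rightarrow> ('k ^ 'h \<Rightarrow> 'k ^ 'n::finite \<Rightarrow> 'k ^ 'n)
    \<Rightarrow> ('k ^ 'n \<Rightarrow> 'k ^ ('h \<times> 'n)) \<Rightarrow> bool" where
  "yd_module H a d \<longleftrightarrow>
     bilin a \<and>
     (\<forall>v. a (unit_el H) v = v) \<and>
     (\<forall>g h v. a (mul H g h) v = a g (a h v)) \<and>
     lin d \<and>
     (\<forall>v. tassoc (tmap (comul H) id (d v)) = tmap id d (d v)) \<and>
     (\<forall>v. sw (d v) (\<lambda>g w. counit H g *s w) = v) \<and>
     (\<forall>h v. d (a h v) =
        sw (comul H h) (\<lambda>h1 h'. sw (comul H h') (\<lambda>h2 h3. sw (d v) (\<lambda>g w.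
          mul H h1 (mul H g (antipode H h3)) \<otimes> a h2 w))))"

definition act2 :: "(('k::field), 'h::finite) bialg \<Rightarrow> ('k, 'h, 'n::finite) yd_bialg
    \<Rightarrow> 'k ^ 'h \<Rightarrow> 'k ^ ('n \<times> 'n) \<Rightarrow> 'k ^ ('n \<times> 'n)" where
  "act2 H R h t = sw (comul H h) (\<lambda>h1 h2. sw t (\<lambda>r s. act R h1 r \<otimes> act R h2 s))"

definition coact2 :: "(('k::field), 'h::finite) bialg \<Rightarrow> ('k, 'h, 'n::finite) yd_bialg
    \<Rightarrow> 'k ^ ('n \<times> 'n) \<Rightarrow> 'k ^ ('h \<times> ('n \<times> 'n))" where
  "coact2 H R t = sw t (\<lambda>r s. sw (coact R r) (\<lambda>r' r0. sw (coact R s) (\<lambda>s' s0.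
     mul H r' s' \<otimes> (r0 \<otimes> s0))))"

definition braided_mul :: "(('k::field), 'h::finite, 'n::finite) yd_bialg
    \<Rightarrow> 'k ^ ('n \<times> 'n) \<Rightarrow> 'k ^ ('n \<times> 'n) \<Rightarrow> 'k ^ ('n \<times> 'n)" where
  "braided_mul R t t' = sw t (\<lambda>r s. sw t' (\<lambda>r' s'. sw (coact R s) (\<lambda>g s0.
     mul R r (act R g r') \<otimes> mul R s0 s')))"

definition yd_hopf_algebra :: "(('k::field), 'h::finite) bialg \<Rightarrow> ('k, 'h, 'n::finite) yd_bialg \<Rightarrow> bool" where
  "yd_hopf_algebra H R \<longleftrightarrow>
     yd_module H (act R) (coact R) \<and>
     algebra_ax R \<and> coalgebra_ax R \<and>
     \<comment> \<open>the structure maps are morphisms of Yetter-Drinfeld modules\<close>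
     (\<forall>h r s. act R h (mul R r s) = sw (act2 H R h (r \<otimes> s)) (mul R)) \<and>
     (\<forall>r s. coact R (mul R r s) = tmap id (\<lambda>t. sw t (mul R)) (coact2 H R (r \<otimes> s))) \<and>
     (\<forall>h. act R h (unit_el R) = counit H h *s unit_el R) \<and>
     coact R (unit_el R) = unit_el H \<otimes> unit_el R \<and>
     (\<forall>h r. comul R (act R h r) = act2 H R h (comul R r)) \<and>
     (\<forall>r. coact2 H R (comul R r) = tmap id (comul R) (coact R r)) \<and>
     (\<forall>h r. counit R (act R h r) = counit H h * counit R r) \<and>
     (\<forall>r. sw (coact R r) (\<lambda>g r0. counit R r0 *s g) = counit R r *s unit_el H) \<and>
     \<comment> \<open>comultiplication and counit are algebra maps, for the braided product on the target\<close>
     (\<forall>r s. comul R (mul R r s) = braided_mul R (comul R r) (comul R s)) \<and>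
     comul R (unit_el R) = unit_el R \<otimes> unit_el R \<and>
     (\<forall>r s. counit R (mul R r s) = counit R r * counit R s) \<and>
     counit R (unit_el R) = 1 \<and>
     (\<exists>S. is_antipode R S \<and> bij S \<and>
        (\<forall>h r. S (act R h r) = act R h (S r)) \<and>
        (\<forall>r. coact R (S r) = tmap id S (coact R r)))"

definition bosonization :: "(('k::field), 'h::finite) bialg \<Rightarrow> ('k, 'h, 'n::finite) yd_bialg
    \<Rightarrow> ('k, 'n \<times> 'h) bialg" where
  "bosonization H R = \<lparr>
     mul = (\<lambda>x y. sw x (\<lambda>r h. sw y (\<lambda>r' h'. sw (comul H h) (\<lambda>h1 h2.
       mul R r (act R h1 r') \<otimes> mul H h2 h')))),
     unit_el = unit_el R \<otimes> unit_el H,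
     comul = (\<lambda>x. sw x (\<lambda>r h. sw (comul R r) (\<lambda>r1 r2. sw (coact R r2) (\<lambda>g r20.
       sw (comul H h) (\<lambda>h1 h2. (r1 \<otimes> mul H g h1) \<otimes> (r20 \<otimes> h2)))))),
     counit = (\<lambda>x. counit H (sw x (\<lambda>r h. counit R r *s h)))\<rparr>"

section \<open>Braided twists\<close>

text \<open>In the last condition \<open>J1, J2\<close> and \<open>I1, I2\<close> are the legs of two copies of \<open>J\<close>.\<close>

definition braided_twist :: "(('k::field), 'h::finite) bialg \<Rightarrow> ('k, 'h, 'n::finite) yd_bialg
    \<Rightarrow> 'k ^ ('n \<times> 'n) \<Rightarrow> bool" where
  "braided_twist H R J \<longleftrightarrow>
     invertible_in (braided_mul R) (unit_el R \<otimes> unit_el R) J \<and>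
     coact2 H R J = unit_el H \<otimes> J \<and>
     (\<forall>h. act2 H R h J = counit H h *s J) \<and>
     sw J (\<lambda>a b. counit R a *s b) = unit_el R \<and>
     sw J (\<lambda>a b. counit R b *s a) = unit_el R \<and>
     sw J (\<lambda>J1 J2. sw J (\<lambda>I1 I2. sw (coact R I2) (\<lambda>g I20. sw (comul R J2) (\<lambda>x y.
       J1 \<otimes> (mul R I1 (act R g x) \<otimes> mul R I20 y))))) =
     sw J (\<lambda>J1 J2. sw J (\<lambda>I1 I2. sw (coact R I2) (\<lambda>g I20. sw (comul R J1) (\<lambda>x y.
       mul R I1 (act R g x) \<otimes> (mul R I20 y \<otimes> J2)))))"

definition braided_twisted :: "(('k::field), 'h::finite, 'n::finite) yd_bialg \<Rightarrow> 'k ^ ('n \<times> 'n)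
    \<Rightarrow> ('k, 'h, 'n) yd_bialg" where
  "braided_twisted R J = R\<lparr>comul := \<lambda>r.
     braided_mul R (braided_mul R J (comul R r))
       (inverse_in (braided_mul R) (unit_el R \<otimes> unit_el R) J)\<rparr>"

text \<open>The element \<open>J\<^sup>1 # J\<^sup>2\<^sub>(\<^sub>-\<^sub>1\<^sub>) \<otimes> J\<^sup>2\<^sub>(\<^sub>0\<^sub>) # 1\<close>.\<close>

definition bos_twist :: "(('k::field), 'h::finite) bialg \<Rightarrow> ('k, 'h, 'n::finite) yd_bialg
    \<Rightarrow> 'k ^ ('n \<times> 'n) \<Rightarrow> 'k ^ (('n \<times> 'h) \<times> ('n \<times> 'h))" where
  "bos_twist H R J = sw J (\<lambda>J1 J2. sw (coact R J2) (\<lambda>g J20.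
     (J1 \<otimes> g) \<otimes> (J20 \<otimes> unit_el H)))"

text \<open>
  The image in \<open>A \<otimes> A\<close>, \<open>A = R # H\<close>, of an element of \<open>H \<otimes> H\<close> under the inclusion
  \<open>H \<rightarrow> A\<close>, \<open>h \<mapsto> 1 # h\<close>. It depends only on the unit of \<open>R\<close>, hence is the same for
  \<open>R\<close> and for its braided twists.
\<close>

definition embed2 :: "(('k::field), 'h::finite, 'n::finite) yd_bialg \<Rightarrow> 'k ^ ('h \<times> 'h)
    \<Rightarrow> 'k ^ (('n \<times> 'h) \<times> ('n \<times> 'h))" where
  "embed2 R F = tmap (\<lambda>h. unit_el R \<otimes> h) (\<lambda>h. unit_el R \<otimes> h) F"

definition bos_twist_by :: "(('k::field), 'h::finite) bialg \<Rightarrow> ('k, 'h, 'n::finite) yd_bialg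
    \<Rightarrow> 'k ^ ('n \<times> 'n) \<Rightarrow> 'k ^ ('h \<times> 'h) \<Rightarrow> 'k ^ (('n \<times> 'h) \<times> ('n \<times> 'h))" where
  "bos_twist_by H R J F =
     (let A = bosonization H R in
      tensor_mul (mul A) (mul A) (embed2 R F) (bos_twist H R J))"

end

theory Submission
  imports Defs
begin

text \<open>
  Let \<open>\<iota> : R \<otimes> R \<rightarrow> A \<otimes> A\<close> be the linear map \<open>r \<otimes> s \<mapsto> r # s\<^sub>(\<^sub>-\<^sub>1\<^sub>) \<otimes> s\<^sub>(\<^sub>0\<^sub>) # 1\<close>, so that the proposed
  twist is \<open>\<iota> J\<close>, and regard \<open>H \<otimes> H\<close> as a subalgebra of \<open>A \<otimes> A\<close>. The coproduct of the bosonization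
  is \<open>\<Delta>(r # h) = \<iota>(\<Delta>(r)) \<Delta>(h)\<close>. Everything follows from the behaviour of \<open>\<iota>\<close>.

  \<^item> It is an injective algebra homomorphism for the braided product (\<open>iota_mult\<close>, \<open>iota_inj\<close>).
  \<^item> It satisfies \<open>\<Delta>(h) \<iota>(t) = \<iota>(h\<^sub>(\<^sub>1\<^sub>) \<cdot> t) \<Delta>(h\<^sub>(\<^sub>2\<^sub>))\<close> for \<open>h\<close> in \<open>H\<close> (\<open>emb_iota\<close>), which is the
    Yetter-Drinfeld condition.
  \<^item> The coproduct of \<open>A\<close>, applied to either leg of \<open>\<iota>(t)\<close>, gives the image of the coproduct of \<open>R\<close>
    on that leg of \<open>t\<close> under one and the same map \<open>R \<otimes> R \<otimes> R \<rightarrow> A \<otimes> A \<otimes> A\<close> (\<open>comul_fst_iota\<close>,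
    \<open>comul_snd_iota\<close>).

  From the first two properties the coproduct of \<open>A\<close> is multiplicative, from the third it is
  coassociative, and an explicit antipode makes \<open>A\<close> a Hopf algebra. If \<open>J\<close> is a braided twist, then
  the third property turns the braided cocycle condition into the cocycle condition for \<open>\<iota> J\<close>; the
  first one shows that \<open>\<iota> J\<close> is invertible. Invariance of \<open>J\<close> makes \<open>\<iota> J\<close> commute with \<open>\<Delta>(h)\<close> by
  the second property, whence
  \<open>\<iota>(J \<Delta>(r) J\<^sup>-\<^sup>1) \<Delta>(h) = \<iota>(J) \<Delta>(r # h) \<iota>(J)\<^sup>-\<^sup>1\<close>. So the bosonization of the twisted \<open>R\<close> and the
  twisted bosonization are equal, and the isomorphism is the identity.

  For the second part, \<open>\<Delta>(h)\<close> is unchanged by the twist \<open>\<iota> J\<close>, so \<open>H\<close> is a sub-bialgebra of the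
  twisted bosonization and \<open>F\<close> is a twist for the latter (\<open>twist_transport\<close>). Twisting first by
  \<open>\<iota> J\<close> and then by \<open>F\<close> is twisting by \<open>F \<iota>(J)\<close> (\<open>twist_compose\<close>), and again the isomorphism is
  the identity. That all these bialgebras are Hopf algebras is the general fact that a twist of a
  Hopf algebra is one, its antipode being conjugate to the original (\<open>hopf_algebra_twisted\<close>).
\<close>

section \<open>Sweedler calculus\<close>

text \<open>
  The two collections mechanise Sweedler calculus. The rules \<open>lin_intros\<close> prove linearity of
  explicit expressions in one of their variables. The rules \<open>sweedler\<close> move every \<open>sw\<close> to the
  outside and evaluate it on pure tensors, which turns both sides of an identity into iterated
  \<open>sw\<close> around one multilinear expression. What has to be supplied by hand is the use of
  coassociativity and the order of independent summations. The latter is changed by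
  \<open>sw_commute\<close> with its outer tensor instantiated, so that this tensor is moved inwards past all
  the others; left general, the rule does not terminate.
\<close>

named_theorems lin_intros
named_theorems sweedler

lemma lin_iff: "lin f \<longleftrightarrow> (\<forall>x y. f (x + y) = f x + f y) \<and> (\<forall>c x. f (c *s x) = c *s f x)"
  by (auto simp: Vector_Spaces.linear_iff vec.vector_space_axioms)

lemma lin_id [lin_intros]: "lin (\<lambda>x. x)"
  by (simp add: lin_iff)

lemma lin_tensor_left [lin_intros]: "lin f \<Longrightarrow> lin (\<lambda>x. f x \<otimes> c)"
  by (simp add: lin_iff tensor_def vec_eq_iff algebra_simps)

lemma lin_tensor_right [lin_intros]: "lin f \<Longrightarrow> lin (\<lambda>x. c \<otimes> f x)"
  by (simp add: lin_iff tensor_def vec_eq_iff algebra_simps)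

lemma lin_sw_left [lin_intros]: "lin f \<Longrightarrow> lin (\<lambda>x. sw (f x) b)"
  using lin_sw[of b] by (simp add: lin_iff)

lemma lin_sw_right [lin_intros]: "(\<And>a b. lin (\<lambda>x. F x a b)) \<Longrightarrow> lin (\<lambda>x. sw t (F x))"
proof -
  assume "\<And>a b. lin (\<lambda>x. F x a b)"
  then have F: "F (x + y) a b = F x a b + F y a b" "F (c *s x) a b = c *s F x a b" for x y a b c
    by (simp_all only: lin_iff)
  show ?thesis
    unfolding lin_iff sw_def F
    by (simp only: vec.scale_right_distrib sum.distrib vec.scale_sum_right vec.scale_scale
        mult.commute simp_thms)
qed

lemma lin_scale [lin_intros]: "lin f \<Longrightarrow> lin (\<lambda>x. c *s f x)"
  by (simp only: lin_iff vec.scale_right_distrib vec.scale_scale mult.commute simp_thms)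

lemma lin_comp: "lin g \<Longrightarrow> lin f \<Longrightarrow> lin (\<lambda>x. g (f x))"
  by (simp add: lin_iff)

lemma lin_tmap [lin_intros]: "lin f \<Longrightarrow> lin (\<lambda>x. tmap g h (f x))"
  unfolding tmap_def by (intro lin_intros)

lemma lin_tassoc [lin_intros]: "lin f \<Longrightarrow> lin (\<lambda>x. tassoc (f x))"
  by (simp add: lin_iff tassoc_def vec_eq_iff)

lemma bilinI: "(\<And>y. lin (\<lambda>x. b x y)) \<Longrightarrow> (\<And>x. lin (\<lambda>y. b x y)) \<Longrightarrow> bilin b"
  by (simp add: bilin_def)

lemma bilin1: "bilin b \<Longrightarrow> lin f \<Longrightarrow> lin (\<lambda>x. b (f x) y)"
  by (simp add: bilin_def lin_iff)
lemma bilin2: "bilin b \<Longrightarrow> lin f \<Longrightarrow> lin (\<lambda>x. b y (f x))"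
  by (simp add: bilin_def lin_iff)

lemma lin_sw_apply: "lin f \<Longrightarrow> f (sw t b) = sw t (\<lambda>x y. f (b x y))"
  by (simp add: sw_def vec.linear_sum vec.linear_scale)

lemma sw_sw: "sw (sw t b) c = sw t (\<lambda>x y. sw (b x y) c)"
  by (rule lin_sw_apply) (rule lin_sw)

lemma sw_commute: "sw s (\<lambda>a b. sw t (\<lambda>c d. F a b c d)) = sw t (\<lambda>c d. sw s (\<lambda>a b. F a b c d))"
  unfolding sw_def vec.scale_sum_right
  by (subst sum.swap) (simp only: vec.scale_scale mult.commute)

lemma sw_scale: "sw t (\<lambda>a b. c *s F a b) = c *s sw t F"
  by (simp only: sw_def vec.scale_sum_right vec.scale_scale mult.commute)

lemma sw_eq_self: "sw t (\<lambda>a b. a \<otimes> b) = t"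
  by (rule linear_eq_sw[OF lin_id, symmetric])

lemma lin_eqI:
  assumes "lin f" "lin g" "\<And>a b. f (a \<otimes> b) = g (a \<otimes> b)"
  shows "f t = g t"
  unfolding linear_eq_sw[OF assms(1), of t] linear_eq_sw[OF assms(2), of t] assms(3) ..

lemma tmap_tensor: "lin f \<Longrightarrow> lin g \<Longrightarrow> tmap f g (a \<otimes> b) = f a \<otimes> g b"
  unfolding tmap_def by (subst sw_tensor) (auto intro!: bilinI lin_intros lin_comp)

lemma lin_form_iff: "lin_form f \<longleftrightarrow> (\<forall>x y. f (x + y) = f x + f y) \<and> (\<forall>c x. f (c *s x) = c * f x)"
  by (auto simp: Vector_Spaces.linear_iff vec.vector_space_axioms vector_space_over_itself.vector_space_axioms)

lemma lin_scale_left [lin_intros]: "lin_form f \<Longrightarrow> lin (\<lambda>x. f x *s v)"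
  by (simp add: lin_form_iff lin_iff vec.scale_left_distrib)

lemma lin_form_mult_left [lin_intros]: "lin_form f \<Longrightarrow> lin_form (\<lambda>x. f x * c)"
  and lin_form_mult_right [lin_intros]: "lin_form f \<Longrightarrow> lin_form (\<lambda>x. c * f x)"
  by (simp_all add: lin_form_iff algebra_simps)

lemma lin_form_comp: "lin_form g \<Longrightarrow> lin f \<Longrightarrow> lin_form (\<lambda>x. g (f x))"
  by (simp add: lin_iff lin_form_iff)

lemma lin_form_sw_apply: "lin_form f \<Longrightarrow> f (sw t b) *s v = sw t (\<lambda>x y. f (b x y) *s v)"
  by (rule lin_sw_apply) (rule lin_scale_left)

lemma lin_scale_apply: "lin f \<Longrightarrow> f (c *s x) = c *s f x"
  by (simp add: lin_iff)

lemma sw_tensor_lin [sweedler]: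
  "(\<And>x. lin (\<lambda>y. b x y)) \<Longrightarrow> (\<And>y. lin (\<lambda>x. b x y)) \<Longrightarrow> sw (v \<otimes> w) b = b v w"
  by (rule sw_tensor) (simp add: bilin_def)

lemma tensor_sw_left [sweedler]: "sw t b \<otimes> y = sw t (\<lambda>c d. b c d \<otimes> y)"
  and tensor_sw_right [sweedler]: "y \<otimes> sw t b = sw t (\<lambda>c d. y \<otimes> b c d)"
  by (rule lin_sw_apply, intro lin_intros)+

lemma tensor_scale_left [sweedler]: "(c *s x) \<otimes> y = c *s (x \<otimes> y)"
  and tensor_scale_right [sweedler]: "y \<otimes> (c *s x) = c *s (y \<otimes> x)"
  by (rule lin_scale_apply, intro lin_intros)+

lemma tassoc_sw [sweedler]: "tassoc (sw t b) = sw t (\<lambda>c d. tassoc (b c d))"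
  by (rule lin_sw_apply, intro lin_intros)

lemmas [sweedler] = sw_sw tassoc_tensor sw_scale

lemma bilin_eqI:
  assumes "\<And>t. lin (\<lambda>s. f s t)" "\<And>s. lin (\<lambda>t. f s t)" "\<And>t. lin (\<lambda>s. g s t)" "\<And>s. lin (\<lambda>t. g s t)"
    and "\<And>a b c d. f (a \<otimes> b) (c \<otimes> d) = g (a \<otimes> b) (c \<otimes> d)"
  shows "f s t = g s t"
  by (rule lin_eqI[where f="\<lambda>s. f s t"], rule assms, rule assms, rule lin_eqI, (rule assms)+)

lemma sw_cong: "(\<And>a b. F a b = G a b) \<Longrightarrow> sw t F = sw t G"
  by (simp add: sw_def)

text \<open>
  A scalar is compared as a multiple of a fixed vector, which reduces linear forms to linear maps.
\<close>

lemma lin_form_eqI: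
  assumes "lin_form f" "lin_form g" "\<And>a b. f (a \<otimes> b) = g (a \<otimes> b)"
  shows "f t = (g t :: 'k::field)"
proof -
  have "f t *s (1 :: 'k ^ 1) = g t *s (1 :: 'k ^ 1)"
    by (rule lin_eqI) (simp_all add: assms lin_scale_left)
  then show ?thesis
    by (simp add: vec_eq_iff)
qed

section \<open>Algebras and their tensor products\<close>

locale alg =
  fixes m :: "('k::field) ^ 'n::finite \<Rightarrow> 'k ^ 'n \<Rightarrow> 'k ^ 'n" and u :: "'k ^ 'n"
  assumes bilin_mult: "bilin m"
    and assoc: "m (m x y) z = m x (m y z)"
    and unit_left [simp]: "m u x = x" and unit_right [simp]: "m x u = x"
begin

lemma lin_mult_left [lin_intros]: "lin f \<Longrightarrow> lin (\<lambda>x. m (f x) y)"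
  using bilin_mult by (rule bilin1)

lemma lin_mult_right [lin_intros]: "lin f \<Longrightarrow> lin (\<lambda>x. m y (f x))"
  using bilin_mult by (rule bilin2)

lemma mult_sw_left [sweedler]: "m (sw t b) y = sw t (\<lambda>c d. m (b c d) y)"
  and mult_sw_right [sweedler]: "m y (sw t b) = sw t (\<lambda>c d. m y (b c d))"
  by (rule lin_sw_apply, intro lin_intros)+

lemma mult_scale_left [sweedler]: "m (c *s x) y = c *s m x y"
  and mult_scale_right [sweedler]: "m y (c *s x) = c *s m y x"
  by (rule lin_scale_apply, intro lin_intros)+

lemma inverse_in_eq: "m x y = u \<Longrightarrow> m y x = u \<Longrightarrow> inverse_in m u x = y"
  unfolding inverse_in_def by (rule the_equality) (metis assoc unit_left unit_right)+

lemma cancel_left: "m x y = u \<Longrightarrow> m x (m y z) = z"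
  by (metis assoc unit_left)

end

lemma lin_tensor_mul_left [lin_intros]: "lin f \<Longrightarrow> lin (\<lambda>x. tensor_mul m m' (f x) y)"
  and lin_tensor_mul_right [lin_intros]: "lin f \<Longrightarrow> lin (\<lambda>x. tensor_mul m m' y (f x))"
  unfolding tensor_mul_def by (intro lin_intros, assumption)+

lemma tensor_mul_sw_left [sweedler]:
    "tensor_mul m m' (sw t b) y = sw t (\<lambda>c d. tensor_mul m m' (b c d) y)"
  and tensor_mul_sw_right [sweedler]:
    "tensor_mul m m' y (sw t b) = sw t (\<lambda>c d. tensor_mul m m' y (b c d))"
  by (rule lin_sw_apply, intro lin_intros)+

lemma tensor_mul_tensor:
  assumes "alg m u" "alg m' u'"
  shows "tensor_mul m m' (a \<otimes> b) (c \<otimes> d) = m a c \<otimes> m' b d"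
proof -
  interpret alg m u by fact
  interpret m': alg m' u' by fact
  show ?thesis
    unfolding tensor_mul_def by (simp add: sweedler lin_intros)
qed

lemma alg_tensor:
  assumes "alg m u" "alg m' u'"
  shows "alg (tensor_mul m m') (u \<otimes> u')"
proof -
  interpret alg m u by fact
  interpret m': alg m' u' by fact
  note [simp] = tensor_mul_tensor[OF assms]
  show ?thesis
  proof
    show "bilin (tensor_mul m m')"
      by (simp add: bilin_def lin_intros)
    show "tensor_mul m m' (u \<otimes> u') x = x" for x
      by (rule lin_eqI[OF _ lin_id]) (simp_all add: lin_intros)
    show "tensor_mul m m' x (u \<otimes> u') = x" for x
      by (rule lin_eqI[OF _ lin_id]) (simp_all add: lin_intros)
    show "tensor_mul m m' (tensor_mul m m' x y) z = tensor_mul m m' x (tensor_mul m m' y z)" for x y z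
      by (rule lin_eqI[where t=z], (intro lin_intros)+, rule bilin_eqI[where s=x and t=y])
        (simp_all add: lin_intros assoc m'.assoc)
  qed
qed

section \<open>Coalgebras and bialgebras\<close>

text \<open>
  The coassociativity of a bosonization will be deduced from the multiplicativity of its coproduct.
  Linear coproducts, and then multiplicative ones, are therefore studied before coassociativity is
  assumed: this is the purpose of \<open>precoalg\<close> and \<open>prebialg\<close>.
\<close>

locale precoalg =
  fixes D :: "('k::field) ^ 'n::finite \<Rightarrow> 'k ^ ('n \<times> 'n)" and e :: "'k ^ 'n \<Rightarrow> 'k"
  assumes lin_comul_map: "lin D" and lin_form_counit: "lin_form e"
begin

lemma lin_comul [lin_intros]: "lin f \<Longrightarrow> lin (\<lambda>x. D (f x))"
  using lin_comul_map by (rule lin_comp)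

lemma lin_counit [lin_intros]: "lin f \<Longrightarrow> lin_form (\<lambda>x. e (f x))"
  using lin_form_counit by (rule lin_form_comp)

lemma counit_scale [sweedler]: "e (c *s x) = c * e x"
  using lin_form_counit by (simp add: lin_form_iff)

end

locale coalg = precoalg +
  assumes coassoc_tmap: "tassoc (tmap D id (D x)) = tmap id D (D x)"
    and counit_left_id: "sw (D x) (\<lambda>a b. e a *s b) = x"
    and counit_right_id: "sw (D x) (\<lambda>a b. e b *s a) = x"
begin

lemma counit_left:
  assumes "lin f"
  shows "sw (D x) (\<lambda>a b. e a *s f b) = f x"
  using lin_sw_apply[OF assms, of "D x" "\<lambda>a b. e a *s b"] counit_left_id[of x]
  by (simp add: lin_scale_apply[OF assms])

lemma counit_right:
  assumes "lin f"
  shows "sw (D x) (\<lambda>a b. e b *s f a) = f x"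
  using lin_sw_apply[OF assms, of "D x" "\<lambda>a b. e b *s a"] counit_right_id[of x]
  by (simp add: lin_scale_apply[OF assms])

lemma coassoc:
  assumes [lin_intros]: "\<And>y z. lin (\<lambda>x. F x y z)" "\<And>x z. lin (\<lambda>y. F x y z)" "\<And>x y. lin (\<lambda>z. F x y z)"
  shows "sw (D x) (\<lambda>a b. sw (D a) (\<lambda>c d. F c d b)) = sw (D x) (\<lambda>a b. sw (D b) (\<lambda>c d. F a c d))"
proof -
  have "sw (tassoc (tmap D id (D x))) (\<lambda>a t. sw t (F a)) = sw (tmap id D (D x)) (\<lambda>a t. sw t (F a))"
    by (simp only: coassoc_tmap)
  moreover have "sw (tmap id D y) (\<lambda>a t. sw t (F a)) = sw y (\<lambda>a b. sw (D b) (\<lambda>c d. F a c d))" for y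
    unfolding tmap_def by (simp add: sweedler lin_intros)
  moreover have "sw (tassoc (t \<otimes> b)) (\<lambda>a t. sw t (F a)) = sw t (\<lambda>c d. F c d b)" for t b
    by (rule lin_eqI) (simp_all add: sweedler lin_intros)
  then have "sw (tassoc (tmap D id y)) (\<lambda>a t. sw t (F a)) = sw y (\<lambda>a b. sw (D a) (\<lambda>c d. F c d b))" for y
    unfolding tmap_def by (simp add: sweedler)
  ultimately show ?thesis
    by simp
qed

text \<open>
  The second bracketing of the fourfold coproduct isolates the two middle legs, to which the
  Yetter-Drinfeld condition applies; the first one is how products of coproducts present themselves.
\<close>

lemma coassoc_balanced:
  assumes [lin_intros]: "\<And>b c d. lin (\<lambda>a. K a b c d)" "\<And>a c d. lin (\<lambda>b. K a b c d)"
    "\<And>a b d. lin (\<lambda>c. K a b c d)" "\<And>a b c. lin (\<lambda>d. K a b c d)"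
  shows "sw (D h) (\<lambda>x y. sw (D x) (\<lambda>a b. sw (D y) (\<lambda>c d. K a b c d)))
    = sw (D h) (\<lambda>a x. sw (D x) (\<lambda>y d. sw (D y) (\<lambda>b c. K a b c d)))"
proof -
  have "sw (D h) (\<lambda>x y. sw (D x) (\<lambda>a b. sw (D y) (\<lambda>c d. K a b c d)))
    = sw (D h) (\<lambda>a x. sw (D x) (\<lambda>b y. sw (D y) (\<lambda>c d. K a b c d)))"
    by (rule coassoc) (intro lin_intros)+
  also have "\<dots> = sw (D h) (\<lambda>a x. sw (D x) (\<lambda>y d. sw (D y) (\<lambda>b c. K a b c d)))"
    by (rule sw_cong, rule coassoc[symmetric]) (intro lin_intros)+
  finally show ?thesis .
qed

end

locale prebialg = alg "mul K" "unit_el K" + precoalg "comul K" "counit K"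
  for K :: "(('k::field), 'n::finite, 'z) bialg_scheme" +
  assumes comul_mult_tensor_mul: "comul K (mul K x y) = tensor_mul (mul K) (mul K) (comul K x) (comul K y)"
    and comul_unit [simp]: "comul K (unit_el K) = unit_el K \<otimes> unit_el K"
    and counit_mult [simp]: "counit K (mul K x y) = counit K x * counit K y"
    and counit_unit [simp]: "counit K (unit_el K) = 1"

locale bialg = prebialg K + coalg "comul K" "counit K"
  for K :: "(('k::field), 'n::finite, 'z) bialg_scheme"

lemma bialgebra_iff: "bialgebra K \<longleftrightarrow> bialg K"
  by (auto simp: bialgebra_def bialg_def prebialg_def prebialg_axioms_def algebra_ax_def
      coalgebra_ax_def alg_def coalg_def precoalg_def coalg_axioms_def)

context prebialg
begin

abbreviation mult (infixr "\<cdot>" 70) where "x \<cdot> y \<equiv> mul K x y"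
abbreviation one ("\<one>") where "\<one> \<equiv> unit_el K"
abbreviation mult2 (infixr "\<cdot>\<^sub>2" 70) where "mult2 \<equiv> tensor_mul (mul K) (mul K)"
abbreviation mult3 (infixr "\<cdot>\<^sub>3" 70) where "mult3 \<equiv> tensor_mul (mul K) mult2"
abbreviation comulK ("\<Delta>") where "\<Delta> \<equiv> comul K"
abbreviation counitK ("\<epsilon>") where "\<epsilon> \<equiv> counit K"

end

sublocale prebialg \<subseteq> K2: alg "tensor_mul (mul K) (mul K)" "unit_el K \<otimes> unit_el K"
  by (rule alg_tensor) unfold_locales

sublocale prebialg \<subseteq> K3: alg "tensor_mul (mul K) (tensor_mul (mul K) (mul K))"
    "unit_el K \<otimes> unit_el K \<otimes> unit_el K"
  by (rule alg_tensor) unfold_locales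

context prebialg
begin

lemma mult2_tensor [simp, sweedler]: "(a \<otimes> b) \<cdot>\<^sub>2 (c \<otimes> d) = (a \<cdot> c) \<otimes> (b \<cdot> d)"
  by (rule tensor_mul_tensor) unfold_locales

lemma mult3_tensor [simp, sweedler]: "(a \<otimes> s) \<cdot>\<^sub>3 (b \<otimes> t) = (a \<cdot> b) \<otimes> (s \<cdot>\<^sub>2 t)"
  by (rule tensor_mul_tensor) unfold_locales

lemma comul_mult:
  "\<Delta> (x \<cdot> y) = sw (\<Delta> x) (\<lambda>a b. sw (\<Delta> y) (\<lambda>c d. (a \<cdot> c) \<otimes> (b \<cdot> d)))"
  by (simp add: comul_mult_tensor_mul tensor_mul_def)

text \<open>
  The maps \<open>id \<otimes> \<Delta>\<close>, \<open>\<Delta> \<otimes> id\<close>, \<open>t \<mapsto> 1 \<otimes> t\<close> and \<open>t \<mapsto> t \<otimes> 1\<close> all take values in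
  \<open>K \<otimes> (K \<otimes> K)\<close> and all are algebra homomorphisms. Hence the theory of twists becomes a
  calculation with invertible elements of one associative algebra.
\<close>

definition comul_snd where "comul_snd t = tmap id \<Delta> t"
definition comul_fst where "comul_fst t = tassoc (tmap \<Delta> id t)"
definition leg23 where "leg23 t = \<one> \<otimes> t"
definition leg12 where "leg12 t = tassoc (t \<otimes> \<one>)"

lemma lin_comul_legs [lin_intros]: "lin f \<Longrightarrow> lin (\<lambda>x. comul_fst (f x))" "lin f \<Longrightarrow> lin (\<lambda>x. comul_snd (f x))"
  "lin f \<Longrightarrow> lin (\<lambda>x. leg12 (f x))" "lin f \<Longrightarrow> lin (\<lambda>x. leg23 (f x))"
  unfolding comul_fst_def comul_snd_def leg12_def leg23_def by (intro lin_intros, assumption)+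

lemma comul_fst_tensor: "comul_fst (a \<otimes> b) = tassoc (\<Delta> a \<otimes> b)"
  and comul_snd_tensor: "comul_snd (a \<otimes> b) = a \<otimes> \<Delta> b"
  by (simp_all add: comul_fst_def comul_snd_def tmap_tensor lin_comul_map vec.linear_id)

lemma comul_snd_mult: "comul_snd (s \<cdot>\<^sub>2 t) = comul_snd s \<cdot>\<^sub>3 comul_snd t"
  by (rule bilin_eqI) (simp_all add: comul_snd_tensor lin_intros comul_mult_tensor_mul)

lemma tassoc_mult: "tassoc (s \<otimes> a) \<cdot>\<^sub>3 tassoc (t \<otimes> b) = tassoc ((s \<cdot>\<^sub>2 t) \<otimes> (a \<cdot> b))"
  by (rule bilin_eqI) (simp_all add: lin_intros tassoc_tensor)

lemma comul_fst_mult: "comul_fst (s \<cdot>\<^sub>2 t) = comul_fst s \<cdot>\<^sub>3 comul_fst t"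
  by (rule bilin_eqI) (simp_all add: comul_fst_tensor lin_intros comul_mult_tensor_mul tassoc_mult)

lemma leg23_mult: "leg23 (s \<cdot>\<^sub>2 t) = leg23 s \<cdot>\<^sub>3 leg23 t"
  by (simp add: leg23_def)

lemma leg12_mult: "leg12 (s \<cdot>\<^sub>2 t) = leg12 s \<cdot>\<^sub>3 leg12 t"
  by (simp add: leg12_def tassoc_mult)

lemma leg_unit [simp]: "comul_fst (\<one> \<otimes> \<one>) = \<one> \<otimes> \<one> \<otimes> \<one>" "comul_snd (\<one> \<otimes> \<one>) = \<one> \<otimes> \<one> \<otimes> \<one>"
  "leg12 (\<one> \<otimes> \<one>) = \<one> \<otimes> \<one> \<otimes> \<one>" "leg23 (\<one> \<otimes> \<one>) = \<one> \<otimes> \<one> \<otimes> \<one>"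
  by (simp_all add: comul_fst_tensor comul_snd_tensor leg12_def leg23_def tassoc_tensor)

definition counit_fst where "counit_fst t = sw t (\<lambda>a b. \<epsilon> a *s b)"
definition counit_snd where "counit_snd t = sw t (\<lambda>a b. \<epsilon> b *s a)"

lemma lin_counit_legs [lin_intros]: "lin f \<Longrightarrow> lin (\<lambda>x. counit_fst (f x))" "lin f \<Longrightarrow> lin (\<lambda>x. counit_snd (f x))"
  unfolding counit_fst_def counit_snd_def by (intro lin_intros, assumption)+

lemma counit_legs_tensor [simp]: "counit_fst (a \<otimes> b) = \<epsilon> a *s b" "counit_snd (a \<otimes> b) = \<epsilon> b *s a"
  unfolding counit_fst_def counit_snd_def by (simp_all add: sweedler lin_intros)

lemma counit_fst_mult: "counit_fst (s \<cdot>\<^sub>2 t) = counit_fst s \<cdot> counit_fst t"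
  by (rule bilin_eqI) (simp_all add: lin_intros sweedler mult.commute)

lemma counit_snd_mult: "counit_snd (s \<cdot>\<^sub>2 t) = counit_snd s \<cdot> counit_snd t"
  by (rule bilin_eqI) (simp_all add: lin_intros sweedler mult.commute)

definition cocycle where "cocycle J \<longleftrightarrow> leg23 J \<cdot>\<^sub>3 comul_snd J = leg12 J \<cdot>\<^sub>3 comul_fst J"

lemma twist_iff: "twist K J \<longleftrightarrow>
  (\<exists>I. J \<cdot>\<^sub>2 I = \<one> \<otimes> \<one> \<and> I \<cdot>\<^sub>2 J = \<one> \<otimes> \<one>) \<and> cocycle J \<and> counit_snd J = \<one> \<and> counit_fst J = \<one>"
  by (simp add: twist_def invertible_in_def cocycle_def counit_fst_def counit_snd_def leg12_def leg23_def
      comul_fst_def comul_snd_def Let_def)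

end

context bialg
begin

lemma coassoc_legs: "comul_fst (\<Delta> x) = comul_snd (\<Delta> x)"
  by (simp add: comul_fst_def comul_snd_def coassoc_tmap)

lemma counit_legs_comul [simp]: "counit_fst (\<Delta> x) = x" "counit_snd (\<Delta> x) = x"
  by (simp_all add: counit_fst_def counit_snd_def counit_left_id counit_right_id)

end

section \<open>Twists of bialgebras\<close>

locale twisted_bialg = bialg K for K :: "(('k::field), 'n::finite) bialg" +
  fixes J I
  assumes twist: "twist K J"
    and JI: "J \<cdot>\<^sub>2 I = \<one> \<otimes> \<one>" and IJ: "I \<cdot>\<^sub>2 J = \<one> \<otimes> \<one>"
begin

abbreviation KJ where "KJ \<equiv> twisted K J"

lemma cocycle: "leg23 J \<cdot>\<^sub>3 comul_snd J = leg12 J \<cdot>\<^sub>3 comul_fst J" and counit_legs_J: "counit_fst J = \<one>" "counit_snd J = \<one>"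
  using twist by (simp_all add: twist_iff cocycle_def)

lemma counit_legs_I: "counit_fst I = \<one>" "counit_snd I = \<one>"
  using arg_cong[OF JI, of counit_fst] arg_cong[OF JI, of counit_snd] by (simp_all add: counit_fst_mult counit_snd_mult counit_legs_J)

lemma twisted_simps [simp]: "mul KJ = mul K" "unit_el KJ = \<one>" "counit KJ = \<epsilon>"
  and comul_twisted: "comul KJ x = (J \<cdot>\<^sub>2 \<Delta> x) \<cdot>\<^sub>2 I"
  using K2.inverse_in_eq[OF JI IJ] by (simp_all add: twisted_def)

lemma cancel2: "J \<cdot>\<^sub>2 (I \<cdot>\<^sub>2 x) = x" "I \<cdot>\<^sub>2 (J \<cdot>\<^sub>2 x) = x"
  by (simp_all add: K2.cancel_left JI IJ)

lemma cancel3: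
  "leg12 J \<cdot>\<^sub>3 leg12 I \<cdot>\<^sub>3 x = x" "leg12 I \<cdot>\<^sub>3 leg12 J \<cdot>\<^sub>3 x = x"
  "leg23 J \<cdot>\<^sub>3 leg23 I \<cdot>\<^sub>3 x = x" "leg23 I \<cdot>\<^sub>3 leg23 J \<cdot>\<^sub>3 x = x"
  "comul_fst J \<cdot>\<^sub>3 comul_fst I \<cdot>\<^sub>3 x = x" "comul_fst I \<cdot>\<^sub>3 comul_fst J \<cdot>\<^sub>3 x = x"
  "comul_snd J \<cdot>\<^sub>3 comul_snd I \<cdot>\<^sub>3 x = x" "comul_snd I \<cdot>\<^sub>3 comul_snd J \<cdot>\<^sub>3 x = x"
  by (rule K3.cancel_left; simp flip: leg12_mult leg23_mult comul_fst_mult comul_snd_mult; simp add: JI IJ)+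

lemma cocycle_assoc: "leg23 J \<cdot>\<^sub>3 comul_snd J \<cdot>\<^sub>3 x = leg12 J \<cdot>\<^sub>3 comul_fst J \<cdot>\<^sub>3 x"
  using cocycle by (metis K3.assoc)

lemma cocycle_inv: "comul_snd I \<cdot>\<^sub>3 leg23 I \<cdot>\<^sub>3 x = comul_fst I \<cdot>\<^sub>3 leg12 I \<cdot>\<^sub>3 x"
  by (metis cocycle_assoc cancel3)

lemma lin_comul_twisted: "lin (comul KJ)"
  unfolding comul_twisted by (intro lin_intros)

lemma comul_snd_twisted: "tmap id (comul KJ) t = leg23 J \<cdot>\<^sub>3 comul_snd t \<cdot>\<^sub>3 leg23 I"
proof (rule lin_eqI[where t=t])
  show "tmap id (comul KJ) (a \<otimes> b) = leg23 J \<cdot>\<^sub>3 comul_snd (a \<otimes> b) \<cdot>\<^sub>3 leg23 I" for a b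
    by (simp add: tmap_tensor lin_comul_twisted vec.linear_id comul_snd_tensor leg23_def comul_twisted
        K2.assoc)
qed (intro lin_intros)+

lemma comul_fst_twisted: "tassoc (tmap (comul KJ) id t) = leg12 J \<cdot>\<^sub>3 comul_fst t \<cdot>\<^sub>3 leg12 I"
proof (rule lin_eqI[where t=t])
  show "tassoc (tmap (comul KJ) id (a \<otimes> b)) = leg12 J \<cdot>\<^sub>3 comul_fst (a \<otimes> b) \<cdot>\<^sub>3 leg12 I" for a b
    by (simp add: tmap_tensor lin_comul_twisted vec.linear_id comul_fst_tensor leg12_def comul_twisted
        K2.assoc tassoc_mult)
qed (intro lin_intros)+

text \<open>
  Coassociativity: with \<open>I\<close> the inverse of \<open>J\<close>, the two iterated coproducts of \<open>x\<close> are
  \<open>(1 \<otimes> J) (id \<otimes> \<Delta>)(J \<Delta>(x) I) (1 \<otimes> I)\<close> and \<open>(J \<otimes> 1) (\<Delta> \<otimes> id)(J \<Delta>(x) I) (I \<otimes> 1)\<close>. The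
  cocycle condition identifies the factors on the left of the iterated coproduct of \<open>K\<close>, and its
  inverse those on the right.
\<close>

lemma bialg_twisted: "bialg KJ"
proof (intro bialg.intro prebialg.intro alg.intro precoalg.intro coalg.intro coalg_axioms.intro prebialg_axioms.intro)
  show "bilin (mul KJ)" using bilin_mult by simp
  show "lin (comul KJ)" by (rule lin_comul_twisted)
  show "lin_form (counit KJ)" using lin_form_counit by simp
  show "tassoc (tmap (comul KJ) id (comul KJ x)) = tmap id (comul KJ) (comul KJ x)" for x
    unfolding comul_fst_twisted comul_snd_twisted comul_twisted comul_fst_mult comul_snd_mult
    by (simp add: K3.assoc cocycle_assoc cocycle_inv coassoc_legs cocycle_inv[of "\<one> \<otimes> \<one> \<otimes> \<one>", simplified])
  have "counit_fst (comul KJ x) = x" "counit_snd (comul KJ x) = x" for x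
    by (simp_all add: comul_twisted counit_fst_mult counit_snd_mult counit_legs_J counit_legs_I)
  then show "sw (comul KJ x) (\<lambda>a b. counit KJ a *s b) = x"
      "sw (comul KJ x) (\<lambda>a b. counit KJ b *s a) = x" for x
    by (simp_all add: counit_fst_def counit_snd_def)
  show "comul KJ (mul KJ x y) = tensor_mul (mul KJ) (mul KJ) (comul KJ x) (comul KJ y)" for x y
    by (simp add: comul_twisted comul_mult_tensor_mul K2.assoc cancel2)
  show "comul KJ (unit_el KJ) = unit_el KJ \<otimes> unit_el KJ"
    by (simp add: comul_twisted JI)
qed (use lin_comul_twisted lin_form_counit in \<open>simp_all add: assoc\<close>)

text \<open>
  The cocycle condition for \<open>F\<close> over \<open>K\<^sup>J\<close> equates
  \<open>(1 \<otimes> F) (1 \<otimes> J) (id \<otimes> \<Delta>)(F) (1 \<otimes> I)\<close> with \<open>(F \<otimes> 1) (J \<otimes> 1) (\<Delta> \<otimes> id)(F) (I \<otimes> 1)\<close>. Multiplying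
  on the right with the cocycle condition for \<open>J\<close> cancels \<open>I\<close> and leaves the one for \<open>F J\<close>.
\<close>

lemma twist_compose:
  assumes "twist KJ F"
  shows "twist K (F \<cdot>\<^sub>2 J)" "twisted KJ F = twisted K (F \<cdot>\<^sub>2 J)"
proof -
  interpret KJ: bialg KJ by (rule bialg_twisted)
  obtain G where FG: "F \<cdot>\<^sub>2 G = \<one> \<otimes> \<one>" "G \<cdot>\<^sub>2 F = \<one> \<otimes> \<one>"
    using assms by (auto simp: KJ.twist_iff)
  have "leg23 F \<cdot>\<^sub>3 leg23 J \<cdot>\<^sub>3 comul_snd F \<cdot>\<^sub>3 leg23 I = leg12 F \<cdot>\<^sub>3 leg12 J \<cdot>\<^sub>3 comul_fst F \<cdot>\<^sub>3 leg12 I"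
    using assms unfolding KJ.twist_iff KJ.cocycle_def KJ.comul_fst_def KJ.comul_snd_def comul_fst_twisted comul_snd_twisted
      KJ.leg12_def KJ.leg23_def by (simp flip: leg12_def leg23_def)
  then have "(leg23 F \<cdot>\<^sub>3 leg23 J \<cdot>\<^sub>3 comul_snd F \<cdot>\<^sub>3 leg23 I) \<cdot>\<^sub>3 (leg23 J \<cdot>\<^sub>3 comul_snd J)
      = (leg12 F \<cdot>\<^sub>3 leg12 J \<cdot>\<^sub>3 comul_fst F \<cdot>\<^sub>3 leg12 I) \<cdot>\<^sub>3 (leg12 J \<cdot>\<^sub>3 comul_fst J)"
    by (simp only: cocycle)
  then have coc: "cocycle (F \<cdot>\<^sub>2 J)"
    unfolding cocycle_def leg12_mult leg23_mult comul_fst_mult comul_snd_mult by (simp add: K3.assoc cancel3)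
  have 1: "(F \<cdot>\<^sub>2 J) \<cdot>\<^sub>2 (I \<cdot>\<^sub>2 G) = \<one> \<otimes> \<one>"
    by (simp add: K2.assoc cancel2 FG)
  have 2: "(I \<cdot>\<^sub>2 G) \<cdot>\<^sub>2 (F \<cdot>\<^sub>2 J) = \<one> \<otimes> \<one>"
    by (simp add: K2.assoc K2.cancel_left[OF FG(2)] IJ)
  have "counit_snd (F \<cdot>\<^sub>2 J) = \<one>" "counit_fst (F \<cdot>\<^sub>2 J) = \<one>"
    using assms by (simp_all add: counit_fst_mult counit_snd_mult counit_legs_J KJ.twist_iff)
      (simp_all add: counit_fst_def counit_snd_def KJ.counit_fst_def KJ.counit_snd_def)
  then show "twist K (F \<cdot>\<^sub>2 J)"
    unfolding twist_iff using coc 1 2 by blast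
  have "comul (twisted KJ F) = comul (twisted K (F \<cdot>\<^sub>2 J))"
    using K2.inverse_in_eq[OF FG] K2.inverse_in_eq[OF 1 2]
    by (simp add: twisted_def fun_eq_iff K2.inverse_in_eq[OF JI IJ] K2.assoc)
  then show "twisted KJ F = twisted K (F \<cdot>\<^sub>2 J)"
    by (simp add: twisted_def fun_eq_iff)
qed

end

text \<open>
  The maps \<open>\<phi> \<otimes> \<phi>\<close> and \<open>\<phi> \<otimes> \<phi> \<otimes> \<phi>\<close> are algebra homomorphisms and commute with every map that
  enters the definition of a twist.
\<close>

lemma twist_transport:
  assumes "bialg H" "bialg K" and phi: "lin \<phi>" "\<And>x y. \<phi> (mul H x y) = mul K (\<phi> x) (\<phi> y)"
    "\<phi> (unit_el H) = unit_el K" "\<And>x. comul K (\<phi> x) = tmap \<phi> \<phi> (comul H x)"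
    "\<And>x. counit K (\<phi> x) = counit H x"
    and F: "twist H F"
  shows "twist K (tmap \<phi> \<phi> F)"
proof -
  interpret H: bialg H by fact
  interpret K: bialg K by fact
  let ?f = "tmap \<phi> \<phi>" let ?f3 = "tmap \<phi> (tmap \<phi> \<phi>)"
  note [lin_intros] = lin_comp[OF phi(1)]
  have lin2: "lin ?f" by (intro lin_intros)
  have [simp]: "?f (a \<otimes> b) = \<phi> a \<otimes> \<phi> b" for a b
    by (simp add: tmap_tensor phi)
  have [simp]: "?f3 (a \<otimes> b) = \<phi> a \<otimes> ?f b" for a b
    by (simp add: tmap_tensor phi lin2)
  have mult: "?f (H.mult2 s t) = K.mult2 (?f s) (?f t)" for s t
    by (rule bilin_eqI) (simp_all add: lin_intros phi)
  have mult3: "?f3 (H.mult3 s t) = K.mult3 (?f3 s) (?f3 t)" for s t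
    by (rule bilin_eqI) (simp_all add: lin_intros phi mult)
  have 3: "?f3 (tassoc (t \<otimes> a)) = tassoc (?f t \<otimes> \<phi> a)" for t a
    by (rule lin_eqI) (simp_all add: tassoc_tensor lin_intros)
  have comul_fst: "K.comul_fst (?f t) = ?f3 (H.comul_fst t)" for t
    by (rule lin_eqI) (simp_all add: lin_intros H.comul_fst_tensor K.comul_fst_tensor phi 3)
  have comul_snd: "K.comul_snd (?f t) = ?f3 (H.comul_snd t)" for t
    by (rule lin_eqI) (simp_all add: lin_intros H.comul_snd_tensor K.comul_snd_tensor phi)
  have emb: "K.leg12 (?f t) = ?f3 (H.leg12 t)" "K.leg23 (?f t) = ?f3 (H.leg23 t)" for t
    by (simp_all add: K.leg12_def K.leg23_def H.leg12_def H.leg23_def phi 3)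
  have eps: "K.counit_fst (?f t) = \<phi> (H.counit_fst t)" "K.counit_snd (?f t) = \<phi> (H.counit_snd t)" for t
    by (rule lin_eqI; simp add: lin_intros phi lin_scale_apply[OF phi(1)])+
  obtain G where FG: "H.mult2 F G = H.one \<otimes> H.one" "H.mult2 G F = H.one \<otimes> H.one"
    using F by (auto simp: H.twist_iff)
  have "K.mult2 (?f F) (?f G) = K.one \<otimes> K.one" "K.mult2 (?f G) (?f F) = K.one \<otimes> K.one"
    by (simp_all add: FG phi flip: mult)
  moreover have "K.cocycle (?f F)"
    using F by (simp add: H.twist_iff K.cocycle_def H.cocycle_def comul_fst comul_snd emb flip: mult3)
  moreover have "K.counit_snd (?f F) = K.one" "K.counit_fst (?f F) = K.one"
    using F by (simp_all add: eps H.twist_iff phi)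
  ultimately show ?thesis
    unfolding K.twist_iff by blast
qed

section \<open>Antipodes of twisted Hopf algebras\<close>

locale hopf = bialg K for K :: "(('k::field), 'n::finite, 'z) bialg_scheme" +
  fixes S
  assumes is_antipode: "is_antipode K S" and bij_antipode: "bij S"

lemma hopf_algebra_iff: "hopf_algebra K \<longleftrightarrow> (\<exists>S. hopf K S)"
  by (auto simp: hopf_algebra_def hopf_def hopf_axioms_def bialgebra_iff)

context hopf
begin

lemma lin_antipode [lin_intros]: "lin f \<Longrightarrow> lin (\<lambda>x. S (f x))"
  using is_antipode lin_comp[of S] by (simp add: is_antipode_def)

lemma antipode_sw [sweedler]: "S (sw t b) = sw t (\<lambda>c d. S (b c d))"
  by (rule lin_sw_apply, intro lin_intros)

lemma antipode_scale [sweedler]: "S (c *s x) = c *s S x"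
  by (rule lin_scale_apply, intro lin_intros)

lemma antipode_left_id: "sw (\<Delta> x) (\<lambda>a b. S a \<cdot> b) = \<epsilon> x *s \<one>"
  and antipode_right_id: "sw (\<Delta> x) (\<lambda>a b. a \<cdot> S b) = \<epsilon> x *s \<one>"
  using is_antipode by (auto simp: is_antipode_def)

lemma antipode_left:
  assumes "lin f"
  shows "sw (\<Delta> x) (\<lambda>a b. f (S a \<cdot> b)) = \<epsilon> x *s f \<one>"
  using lin_sw_apply[OF assms, of "\<Delta> x" "\<lambda>a b. S a \<cdot> b"]
  by (simp add: lin_scale_apply[OF assms] antipode_left_id)

lemma antipode_right:
  assumes "lin f"
  shows "sw (\<Delta> x) (\<lambda>a b. f (a \<cdot> S b)) = \<epsilon> x *s f \<one>"
  using lin_sw_apply[OF assms, of "\<Delta> x" "\<lambda>a b. a \<cdot> S b"]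
  by (simp add: lin_scale_apply[OF assms] antipode_right_id)

lemma antipode_left_mult: "sw (\<Delta> x) (\<lambda>a b. S a \<cdot> b \<cdot> y) = \<epsilon> x *s y"
  using antipode_left[of "\<lambda>a. a \<cdot> y" x] by (simp add: lin_intros assoc)

lemma antipode_right_mult: "sw (\<Delta> x) (\<lambda>a b. a \<cdot> S b \<cdot> y) = \<epsilon> x *s y"
  using antipode_right[of "\<lambda>a. a \<cdot> y" x] by (simp add: lin_intros assoc)

lemma antipode_unique:
  assumes "is_antipode K S'"
  shows "S' = S"
proof
  fix x
  have lin' [lin_intros]: "lin f \<Longrightarrow> lin (\<lambda>x. S' (f x))" for f :: "'k ^ 'n \<Rightarrow> 'k ^ 'n"
    using assms lin_comp[of S'] by (simp add: is_antipode_def)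
  have S': "sw (\<Delta> x) (\<lambda>a b. S' a \<cdot> b) = \<epsilon> x *s \<one>" for x
    using assms by (simp add: is_antipode_def)
  have "S' x = sw (\<Delta> x) (\<lambda>a b. sw (\<Delta> b) (\<lambda>c d. S' a \<cdot> (c \<cdot> S d)))"
    using counit_right[of S' x] lin'[OF lin_id]
    by (simp add: antipode_right_id sweedler flip: mult_sw_right)
  also have "\<dots> = sw (\<Delta> x) (\<lambda>a b. sw (\<Delta> a) (\<lambda>c d. S' c \<cdot> (d \<cdot> S b)))"
    by (subst coassoc) (simp_all add: lin_intros)
  also have "\<dots> = S x"
    using counit_left[of S x] lin_antipode[OF lin_id]
    by (simp add: S' sweedler flip: assoc mult_sw_left)
  finally show "S' x = S x" .
qed

lemma antipode_eq: "antipode K = S"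
  unfolding antipode_def using is_antipode antipode_unique by blast

lemma antipode_unit [simp]: "S \<one> = \<one>"
  using antipode_left_id[of \<one>] by (simp add: sweedler lin_intros)

text \<open>
  Both sides are evaluations of
  \<open>S(x\<^sub>(\<^sub>1\<^sub>) y\<^sub>(\<^sub>1\<^sub>)) x\<^sub>(\<^sub>2\<^sub>) y\<^sub>(\<^sub>2\<^sub>) S(y\<^sub>(\<^sub>3\<^sub>)) S(x\<^sub>(\<^sub>3\<^sub>))\<close>: the last four factors collapse to a counit, and
  so do the first three.
\<close>

lemma antipode_mult: "S (x \<cdot> y) = S y \<cdot> S x"
proof -
  have "S (x \<cdot> y) = sw (\<Delta> x) (\<lambda>x1 x'. sw (\<Delta> x') (\<lambda>x2 x3. sw (\<Delta> y) (\<lambda>y1 y'. sw (\<Delta> y') (\<lambda>y2 y3.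
      S (x1 \<cdot> y1) \<cdot> x2 \<cdot> y2 \<cdot> S y3 \<cdot> S x3))))"
  proof -
    have 1: "sw (\<Delta> y') (\<lambda>y2 y3. S (x1 \<cdot> y1) \<cdot> x2 \<cdot> y2 \<cdot> S y3 \<cdot> S x3)
      = \<epsilon> y' *s (S (x1 \<cdot> y1) \<cdot> x2 \<cdot> S x3)" for x1 y1 x2 x3 y'
      using antipode_right_mult[of y' "S x3"] by (simp add: sweedler flip: mult_sw_right)
    have 2: "sw (\<Delta> y) (\<lambda>y1 y'. \<epsilon> y' *s (S (x1 \<cdot> y1) \<cdot> x2 \<cdot> S x3)) = S (x1 \<cdot> y) \<cdot> x2 \<cdot> S x3" for x1 x2 x3
      by (rule counit_right) (intro lin_intros)
    have 3: "sw (\<Delta> x') (\<lambda>x2 x3. S (x1 \<cdot> y) \<cdot> x2 \<cdot> S x3) = \<epsilon> x' *s S (x1 \<cdot> y)" for x1 x'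
      using antipode_right_id[of x'] by (simp add: sweedler flip: mult_sw_right)
    show ?thesis
      unfolding 1 2 3 by (rule counit_right[symmetric]) (intro lin_intros)
  qed
  also have "\<dots> = sw (\<Delta> x) (\<lambda>x' x3. sw (\<Delta> x') (\<lambda>x1 x2. sw (\<Delta> y) (\<lambda>y' y3. sw (\<Delta> y') (\<lambda>y1 y2.
      S (x1 \<cdot> y1) \<cdot> x2 \<cdot> y2 \<cdot> S y3 \<cdot> S x3))))"
    by (subst (1 2) coassoc) (simp_all add: lin_intros)
  also have "\<dots> = S y \<cdot> S x"
  proof -
    have 1: "sw (\<Delta> x') (\<lambda>x1 x2. sw (\<Delta> y') (\<lambda>y1 y2. S (x1 \<cdot> y1) \<cdot> x2 \<cdot> y2 \<cdot> z)) = (\<epsilon> x' * \<epsilon> y') *s z" for x' y' z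
      using antipode_left_mult[of "x' \<cdot> y'" z] unfolding comul_mult by (simp add: sweedler lin_intros assoc)
    show ?thesis
      by (subst sw_commute[where s="\<Delta> _" and t="\<Delta> y"], simp add: 1)
        (simp add: sw_scale counit_left lin_intros del: vec.scale_scale flip: vec.scale_scale)
  qed
  finally show ?thesis .
qed

lemma lin_inv_antipode [lin_intros]: "lin f \<Longrightarrow> lin (\<lambda>x. inv S (f x))"
proof -
  have "S (inv S x) = x" for x
    using bij_antipode by (simp add: bij_is_surj surj_f_inv_f)
  then have "inv S x = y \<longleftrightarrow> x = S y" for x y
    using bij_antipode by (metis bij_inv_eq_iff)
  then have "lin (inv S)"
    using bij_antipode lin_antipode[OF lin_id] unfolding lin_iff by (simp add: bij_is_surj surj_f_inv_f)
  then show "lin f \<Longrightarrow> lin (\<lambda>x. inv S (f x))" by (rule lin_comp)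
qed

text \<open>
  The inverse of the antipode is an antipode for the opposite coproduct, as one sees by applying
  the antihomomorphism \<open>S\<close>.
\<close>

lemma inv_antipode_left: "sw (\<Delta> x) (\<lambda>a b. inv S b \<cdot> a) = \<epsilon> x *s \<one>"
proof -
  have "S (sw (\<Delta> x) (\<lambda>a b. inv S b \<cdot> a)) = S (\<epsilon> x *s \<one>)"
    using bij_antipode
    by (simp add: antipode_sw antipode_mult antipode_scale bij_is_surj surj_f_inv_f antipode_left_id)
  then show ?thesis
    using bij_antipode by (meson bij_is_inj injD)
qed

lemma inv_antipode_left_lin:
  assumes "lin f"
  shows "sw (\<Delta> x) (\<lambda>a b. f (inv S b \<cdot> a)) = \<epsilon> x *s f \<one>"
  using lin_sw_apply[OF assms, of "\<Delta> x" "\<lambda>a b. inv S b \<cdot> a"]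
  by (simp add: lin_scale_apply[OF assms] inv_antipode_left)

text \<open>
  Through the antipode, \<open>K\<close> becomes a right and a left module over the algebra \<open>K \<otimes> K\<close>. In these
  terms the antipode axioms say that \<open>\<Delta>(x)\<close> acts on \<open>1\<close> as the scalar \<open>\<epsilon>(x)\<close>, and the element
  \<open>J\<^sup>1 S(J\<^sup>2)\<close> that corrects the antipode of a twisted Hopf algebra is the result of \<open>J\<close> acting
  on \<open>1\<close>.
\<close>

definition right_act where "right_act c t = sw t (\<lambda>a b. S a \<cdot> c \<cdot> b)"
definition left_act where "left_act t c = sw t (\<lambda>a b. a \<cdot> c \<cdot> S b)"

lemma lin_act_legs [lin_intros]: "lin f \<Longrightarrow> lin (\<lambda>x. right_act c (f x))" "lin g \<Longrightarrow> lin (\<lambda>x. right_act (g x) t)"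
  "lin g \<Longrightarrow> lin (\<lambda>x. left_act t (g x))" "lin f \<Longrightarrow> lin (\<lambda>x. left_act (f x) c)"
  unfolding right_act_def left_act_def by (intro lin_intros, assumption)+

lemma act_tensor [simp]: "right_act c (a \<otimes> b) = S a \<cdot> c \<cdot> b" "left_act (a \<otimes> b) c = a \<cdot> c \<cdot> S b"
  unfolding right_act_def left_act_def by (simp_all add: sweedler lin_intros)

lemma right_act_mult: "right_act c (s \<cdot>\<^sub>2 t) = right_act (right_act c s) t"
  by (rule bilin_eqI) (simp_all add: lin_intros antipode_mult assoc)

lemma left_act_mult: "left_act (s \<cdot>\<^sub>2 t) c = left_act s (left_act t c)"
  by (rule bilin_eqI) (simp_all add: lin_intros antipode_mult assoc)

lemma act_comul: "right_act \<one> (\<Delta> x) = \<epsilon> x *s \<one>" "left_act (\<Delta> x) \<one> = \<epsilon> x *s \<one>"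
  by (simp_all add: right_act_def left_act_def antipode_left_id antipode_right_id)

end

locale twisted_hopf = hopf K S + twisted_bialg K J I
  for K :: "(('k::field), 'n::finite) bialg" and S J I
begin

definition Q where "Q = left_act J \<one>"
definition Q' where "Q' = right_act \<one> I"

lemma act_inverse: "right_act Q' J = \<one>" "left_act I Q = \<one>"
  by (simp_all add: Q_def Q'_def IJ flip: right_act_mult left_act_mult)

text \<open>
  With \<open>I\<close> the inverse of \<open>J\<close>, the cocycle condition reads
  \<open>(id \<otimes> \<Delta>)(J) (\<Delta> \<otimes> id)(I) = (1 \<otimes> I) (J \<otimes> 1)\<close>. The map \<open>a \<otimes> b \<otimes> c \<mapsto> a S(b) c\<close> sends the right
  side to \<open>Q Q'\<close>, and on the left side it cancels all coproducts.
\<close>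

lemma Q_Q': "Q \<cdot> Q' = \<one>"
proof -
  define \<psi> where "\<psi> v = sw v (\<lambda>a w. sw w (\<lambda>b c. a \<cdot> S b \<cdot> c))" for v
  have lin_psi [lin_intros]: "lin f \<Longrightarrow> lin (\<lambda>x. \<psi> (f x))" for f :: "'k ^ ('n \<times> 'n) \<Rightarrow> _"
    unfolding \<psi>_def by (intro lin_intros)
  have [simp]: "\<psi> (a \<otimes> t) = sw t (\<lambda>b c. a \<cdot> S b \<cdot> c)" for a t
    unfolding \<psi>_def by (simp add: sweedler lin_intros)
  have 1: "\<psi> (leg23 s \<cdot>\<^sub>3 leg12 t) = left_act t \<one> \<cdot> right_act \<one> s" for s t
    by (rule bilin_eqI)
      (simp_all add: lin_intros leg23_def leg12_def tassoc_tensor antipode_mult assoc sweedler)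
  have 2: "\<psi> (comul_snd s \<cdot>\<^sub>3 comul_fst t) = counit_snd s \<cdot> counit_fst t" for s t
  proof (rule bilin_eqI)
    fix a b c d
    have 3: "\<psi> ((a \<otimes> s) \<cdot>\<^sub>3 tassoc (t \<otimes> d)) = a \<cdot> left_act t \<one> \<cdot> right_act \<one> s \<cdot> d" for s t
      by (rule bilin_eqI) (simp_all add: lin_intros tassoc_tensor antipode_mult assoc sweedler)
    show "\<psi> (comul_snd (a \<otimes> b) \<cdot>\<^sub>3 comul_fst (c \<otimes> d)) = counit_snd (a \<otimes> b) \<cdot> counit_fst (c \<otimes> d)"
      unfolding comul_snd_tensor comul_fst_tensor 3 act_comul
      by (simp add: sweedler mult.commute)
  qed (intro lin_intros)+
  have "comul_snd J \<cdot>\<^sub>3 comul_fst I = leg23 I \<cdot>\<^sub>3 leg12 J"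
    by (metis cocycle_assoc cancel3 K3.unit_right)
  then have "left_act J \<one> \<cdot> right_act \<one> I = counit_snd J \<cdot> counit_fst I"
    by (metis 1 2)
  then show ?thesis
    by (simp add: Q_def Q'_def counit_legs_J counit_legs_I)
qed

text \<open>
  One-sided inverses in a finite-dimensional algebra are two-sided.
\<close>

lemma Q'_Q: "Q' \<cdot> Q = \<one>"
proof -
  have "lin (mul K Q)" "lin (mul K Q')" by (intro lin_intros)+
  moreover have "mul K Q \<circ> mul K Q' = id"
    by (simp add: fun_eq_iff cancel_left[OF Q_Q'])
  ultimately have "mul K Q' \<circ> mul K Q = id"
    by (simp add: vec.linear_inverse_left)
  from fun_cong[OF this, of \<one>] show ?thesis
    by simp
qed

definition SJ where "SJ x = Q \<cdot> S x \<cdot> Q'"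

text \<open>
  The coproduct of \<open>K\<^sup>J\<close> acts on \<open>Q'\<close> from the right, and on \<open>Q\<close> from the left, as the product of
  the actions of \<open>J\<close>, \<open>\<Delta>(x)\<close> and \<open>I\<close>. The first of these factors to act yields \<open>1\<close>, on which the
  second acts as \<open>\<epsilon>(x)\<close>, and the third leads back to \<open>Q'\<close>, respectively \<open>Q\<close>.
\<close>

lemma antipode_twisted: "is_antipode KJ SJ"
  unfolding is_antipode_def
proof (intro conjI allI)
  show "lin SJ" unfolding SJ_def by (intro lin_intros)
  fix x
  have "sw t (\<lambda>a b. SJ a \<cdot> b) = Q \<cdot> right_act Q' t" for t
    by (rule lin_eqI) (simp_all add: SJ_def lin_intros sweedler assoc)
  then have "sw (comul KJ x) (\<lambda>a b. SJ a \<cdot> b) = \<epsilon> x *s (Q \<cdot> Q')"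
    using lin_scale_apply[OF lin_act_legs(2)[OF lin_id, of "I"], of "\<epsilon> x" \<one>]
    by (simp add: comul_twisted right_act_mult act_inverse act_comul sweedler flip: Q'_def)
  then show "sw (comul KJ x) (\<lambda>a b. mul KJ (SJ a) b) = counit KJ x *s unit_el KJ"
    by (simp add: Q_Q')
  have "sw t (\<lambda>a b. a \<cdot> SJ b) = left_act t Q \<cdot> Q'" for t
    by (rule lin_eqI) (simp_all add: SJ_def lin_intros sweedler assoc)
  then have "sw (comul KJ x) (\<lambda>a b. a \<cdot> SJ b) = \<epsilon> x *s (Q \<cdot> Q')"
    using lin_scale_apply[OF lin_act_legs(3)[OF lin_id, of J], of "\<epsilon> x" \<one>]
    by (simp add: comul_twisted left_act_mult act_inverse act_comul sweedler flip: Q_def)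
  then show "sw (comul KJ x) (\<lambda>a b. mul KJ a (SJ b)) = counit KJ x *s unit_el KJ"
    by (simp add: Q_Q')
qed

lemma bij_SJ: "bij SJ"
proof (rule o_bij)
  show "SJ \<circ> (\<lambda>x. inv S (Q' \<cdot> x \<cdot> Q)) = id" "(\<lambda>x. inv S (Q' \<cdot> x \<cdot> Q)) \<circ> SJ = id"
    using bij_antipode
    by (auto simp: fun_eq_iff SJ_def assoc cancel_left[OF Q_Q'] cancel_left[OF Q'_Q] Q_Q' Q'_Q
        bij_is_surj surj_f_inv_f bij_is_inj)
qed

lemma hopf_twisted: "hopf_algebra KJ"
  unfolding hopf_algebra_def bialgebra_iff
  using bialg_twisted antipode_twisted bij_SJ by blast

end

lemma hopf_algebra_twisted:
  assumes "hopf_algebra K" "twist K J"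
  shows "hopf_algebra (twisted K J)"
proof -
  obtain S where "hopf K S"
    using assms(1) by (auto simp: hopf_algebra_iff)
  then interpret hopf K S .
  obtain I where "J \<cdot>\<^sub>2 I = \<one> \<otimes> \<one>" "I \<cdot>\<^sub>2 J = \<one> \<otimes> \<one>"
    using assms(2) by (auto simp: twist_iff)
  then interpret twisted_hopf K S J I
    using assms(2) by unfold_locales
  show ?thesis by (rule hopf_twisted)
qed

section \<open>Hopf algebras in the Yetter-Drinfeld category\<close>

locale yd = H: hopf H S for H :: "(('k::field), 'h::finite) bialg" and S +
  fixes R :: "('k, 'h, 'r::finite) yd_bialg"
  assumes yd: "yd_hopf_algebra H R"

sublocale yd \<subseteq> R: alg "mul R" "unit_el R"
  using yd by (simp add: yd_hopf_algebra_def algebra_ax_def alg_def)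

sublocale yd \<subseteq> R: coalg "comul R" "counit R"
  using yd by (simp add: yd_hopf_algebra_def coalgebra_ax_def coalg_def precoalg_def coalg_axioms_def)

context yd
begin

text \<open>
  The linear map \<open>bos_twist H R\<close> is defined on all of \<open>R \<otimes> R\<close>, where it sends \<open>r \<otimes> s\<close> to
  \<open>r # s\<^sub>(\<^sub>-\<^sub>1\<^sub>) \<otimes> s\<^sub>(\<^sub>0\<^sub>) # 1\<close>; as a map it is written \<open>\<iota>\<close>.
\<close>

abbreviation multH (infixr "\<cdot>" 70) where "x \<cdot> y \<equiv> mul H x y"
abbreviation multR (infixr "\<bullet>" 70) where "x \<bullet> y \<equiv> mul R x y"
abbreviation oneR ("\<one>\<^sub>R") where "\<one>\<^sub>R \<equiv> unit_el R"
abbreviation actR (infixr "\<rhd>" 73) where "h \<rhd> r \<equiv> act R h r"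
abbreviation coactR ("\<delta>") where "\<delta> \<equiv> coact R"
abbreviation comulR ("\<Delta>\<^sub>R") where "\<Delta>\<^sub>R \<equiv> comul R"
abbreviation counitR ("\<epsilon>\<^sub>R") where "\<epsilon>\<^sub>R \<equiv> counit R"
abbreviation multRR (infixr "\<bullet>\<^sub>2" 70) where "x \<bullet>\<^sub>2 y \<equiv> braided_mul R x y"
abbreviation A where "A \<equiv> bosonization H R"
abbreviation multA (infixr "\<star>" 70) where "x \<star> y \<equiv> mul A x y"
abbreviation multA2 (infixr "\<star>\<^sub>2" 70) where "multA2 \<equiv> tensor_mul (mul A) (mul A)"
abbreviation multA3 (infixr "\<star>\<^sub>3" 70) where "multA3 \<equiv> tensor_mul (mul A) multA2"
abbreviation comulA ("\<Delta>\<^sub>A") where "\<Delta>\<^sub>A \<equiv> comul A"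
abbreviation comulH ("\<Delta>") where "\<Delta> \<equiv> comul H"
abbreviation counitH ("\<epsilon>") where "\<epsilon> \<equiv> counit H"
abbreviation oneH ("\<one>") where "\<one> \<equiv> unit_el H"
abbreviation oneA ("\<one>\<^sub>A") where "\<one>\<^sub>A \<equiv> unit_el A"
abbreviation iota ("\<iota>") where "\<iota> \<equiv> bos_twist H R"
abbreviation emb where "emb \<equiv> embed2 R"

lemma yd_module: "yd_module H (act R) \<delta>"
  using yd by (simp add: yd_hopf_algebra_def)

lemma lin_act_left [lin_intros]: "lin f \<Longrightarrow> lin (\<lambda>x. f x \<rhd> r)"
  and lin_act_right [lin_intros]: "lin g \<Longrightarrow> lin (\<lambda>x. h \<rhd> g x)"
  and lin_coact [lin_intros]: "lin g \<Longrightarrow> lin (\<lambda>x. \<delta> (g x))"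
  using yd_module unfolding yd_module_def by (auto intro: bilin1 bilin2 lin_comp[of \<delta>])

lemma act_unit [simp]: "\<one> \<rhd> r = r"
  and act_act: "g \<rhd> h \<rhd> r = (g \<cdot> h) \<rhd> r"
  using yd_module by (simp_all add: yd_module_def)

lemma act_oneR [simp]: "h \<rhd> \<one>\<^sub>R = \<epsilon> h *s \<one>\<^sub>R"
  and coact_oneR [simp]: "\<delta> \<one>\<^sub>R = \<one> \<otimes> \<one>\<^sub>R"
  and comul_oneR [simp]: "\<Delta>\<^sub>R \<one>\<^sub>R = \<one>\<^sub>R \<otimes> \<one>\<^sub>R"
  and counit_oneR [simp]: "\<epsilon>\<^sub>R \<one>\<^sub>R = 1"
  and counit_multR [simp]: "\<epsilon>\<^sub>R (r \<bullet> s) = \<epsilon>\<^sub>R r * \<epsilon>\<^sub>R s"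
  and counit_act [simp]: "\<epsilon>\<^sub>R (h \<rhd> r) = \<epsilon> h * \<epsilon>\<^sub>R r"
  and comul_multR: "\<Delta>\<^sub>R (r \<bullet> s) = \<Delta>\<^sub>R r \<bullet>\<^sub>2 \<Delta>\<^sub>R s"
  and comul_act: "\<Delta>\<^sub>R (h \<rhd> r) = act2 H R h (\<Delta>\<^sub>R r)"
  and coact2_comul: "coact2 H R (\<Delta>\<^sub>R r) = tmap id \<Delta>\<^sub>R (\<delta> r)"
  using yd by (simp_all add: yd_hopf_algebra_def)

lemma lin_act2 [lin_intros]: "lin f \<Longrightarrow> lin (\<lambda>x. act2 H R (f x) t)" "lin g \<Longrightarrow> lin (\<lambda>x. act2 H R h (g x))"
  and lin_coact2 [lin_intros]: "lin g \<Longrightarrow> lin (\<lambda>x. coact2 H R (g x))"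
  and lin_multRR [lin_intros]: "lin g \<Longrightarrow> lin (\<lambda>x. g x \<bullet>\<^sub>2 t)" "lin g \<Longrightarrow> lin (\<lambda>x. t \<bullet>\<^sub>2 g x)"
  unfolding act2_def coact2_def braided_mul_def by (intro lin_intros, assumption)+

lemma act2_tensor: "act2 H R h (r \<otimes> s) = sw (\<Delta> h) (\<lambda>a b. (a \<rhd> r) \<otimes> (b \<rhd> s))"
  and coact2_tensor: "coact2 H R (r \<otimes> s) = sw (\<delta> r) (\<lambda>g r0. sw (\<delta> s) (\<lambda>g' s0. (g \<cdot> g') \<otimes> r0 \<otimes> s0))"
  and multRR_tensor: "(a \<otimes> b) \<bullet>\<^sub>2 (c \<otimes> d) = sw (\<delta> b) (\<lambda>g b0. (a \<bullet> (g \<rhd> c)) \<otimes> (b0 \<bullet> d))"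
  unfolding act2_def coact2_def braided_mul_def by (simp_all add: sweedler lin_intros)

lemma multRR_sw [sweedler]: "sw t b' \<bullet>\<^sub>2 r = sw t (\<lambda>c d. b' c d \<bullet>\<^sub>2 r)" "r \<bullet>\<^sub>2 sw t b' = sw t (\<lambda>c d. r \<bullet>\<^sub>2 b' c d)"
  and coact2_sw [sweedler]: "coact2 H R (sw t b') = sw t (\<lambda>c d. coact2 H R (b' c d))"
  and act2_sw [sweedler]: "act2 H R h (sw t b') = sw t (\<lambda>c d. act2 H R h (b' c d))"
  by (rule lin_sw_apply, intro lin_intros)+

lemma act_multR: "h \<rhd> (r \<bullet> s) = sw (\<Delta> h) (\<lambda>a b. (a \<rhd> r) \<bullet> (b \<rhd> s))"
  using yd by (simp add: yd_hopf_algebra_def act2_tensor sweedler lin_intros)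

lemma coact_multR: "\<delta> (r \<bullet> s) = sw (\<delta> r) (\<lambda>g r0. sw (\<delta> s) (\<lambda>g' s0. (g \<cdot> g') \<otimes> (r0 \<bullet> s0)))"
  using yd by (simp add: yd_hopf_algebra_def coact2_tensor sweedler lin_intros tmap_def)

lemma counit_coact: "lin f \<Longrightarrow> sw (\<delta> v) (\<lambda>g w. \<epsilon> g *s f w) = f v"
  using yd_module lin_sw_apply[of f "\<delta> v" "\<lambda>g w. \<epsilon> g *s w"] lin_scale_apply[of f]
  by (simp add: yd_module_def)

lemma counitR_coact: "lin f \<Longrightarrow> sw (\<delta> r) (\<lambda>g r0. \<epsilon>\<^sub>R r0 *s f g) = \<epsilon>\<^sub>R r *s f \<one>"
  using yd lin_sw_apply[of f "\<delta> r" "\<lambda>g r0. \<epsilon>\<^sub>R r0 *s g"] lin_scale_apply[of f]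
  by (simp add: yd_hopf_algebra_def)

lemma coact_coassoc:
  assumes [lin_intros]: "\<And>y z. lin (\<lambda>x. F x y z)" "\<And>x z. lin (\<lambda>y. F x y z)" "\<And>x y. lin (\<lambda>z. F x y z)"
  shows "sw (\<delta> v) (\<lambda>g w. sw (\<Delta> g) (\<lambda>a b. F a b w)) = sw (\<delta> v) (\<lambda>a w. sw (\<delta> w) (\<lambda>b w0. F a b w0))"
proof -
  have "tassoc (tmap \<Delta> id (\<delta> v)) = tmap id \<delta> (\<delta> v)"
    using yd_module by (simp add: yd_module_def)
  then have "sw (tassoc (tmap \<Delta> id (\<delta> v))) (\<lambda>a t. sw t (F a)) = sw (tmap id \<delta> (\<delta> v)) (\<lambda>a t. sw t (F a))"
    by simp
  moreover have "sw (tmap id \<delta> y) (\<lambda>a t. sw t (F a)) = sw y (\<lambda>a b. sw (\<delta> b) (\<lambda>c d. F a c d))" for y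
    unfolding tmap_def by (simp add: sweedler lin_intros)
  moreover have "sw (tassoc (t \<otimes> b)) (\<lambda>a t. sw t (F a)) = sw t (\<lambda>c d. F c d b)" for t b
    by (rule lin_eqI) (simp_all add: sweedler lin_intros)
  then have "sw (tassoc (tmap \<Delta> id y)) (\<lambda>a t. sw t (F a)) = sw y (\<lambda>a b. sw (\<Delta> a) (\<lambda>c d. F c d b))" for y
    unfolding tmap_def by (simp add: sweedler)
  ultimately show ?thesis
    by simp
qed

lemma coact_act:
  "\<delta> (h \<rhd> v) = sw (\<Delta> h) (\<lambda>h1 h'. sw (\<Delta> h') (\<lambda>h2 h3. sw (\<delta> v) (\<lambda>g w.
          (h1 \<cdot> g \<cdot> S h3) \<otimes> (h2 \<rhd> w))))"
  using yd_module by (simp add: yd_module_def H.antipode_eq)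

text \<open>
  The Yetter-Drinfeld condition in its form without antipode,
  \<open>(h\<^sub>(\<^sub>1\<^sub>) \<cdot> v)\<^sub>(\<^sub>-\<^sub>1\<^sub>) h\<^sub>(\<^sub>2\<^sub>) \<otimes> (h\<^sub>(\<^sub>1\<^sub>) \<cdot> v)\<^sub>(\<^sub>0\<^sub>) = h\<^sub>(\<^sub>1\<^sub>) v\<^sub>(\<^sub>-\<^sub>1\<^sub>) \<otimes> h\<^sub>(\<^sub>2\<^sub>) \<cdot> v\<^sub>(\<^sub>0\<^sub>)\<close>: in the formula for the coaction
  of \<open>h\<^sub>(\<^sub>1\<^sub>) \<cdot> v\<close>, the factor \<open>S(h\<^sub>(\<^sub>3\<^sub>))\<close> meets \<open>h\<^sub>(\<^sub>4\<^sub>)\<close> and cancels.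
\<close>

lemma yd_compat:
  assumes F: "\<And>y. lin (\<lambda>x. F x y)" "\<And>x. lin (\<lambda>y. F x y)"
  shows "sw (\<Delta> h) (\<lambda>h1 h2. sw (\<delta> (h1 \<rhd> v)) (\<lambda>g w. F (g \<cdot> h2) w))
    = sw (\<Delta> h) (\<lambda>h1 h2. sw (\<delta> v) (\<lambda>g w. F (h1 \<cdot> g) (h2 \<rhd> w)))"
proof -
  note [lin_intros] = lin_comp[OF F(1)] lin_comp[OF F(2)]
  have "sw (\<Delta> h) (\<lambda>h1 h2. sw (\<delta> (h1 \<rhd> v)) (\<lambda>g w. F (g \<cdot> h2) w))
    = sw (\<Delta> h) (\<lambda>h' h4. sw (\<Delta> h') (\<lambda>h1 h''. sw (\<Delta> h'') (\<lambda>h2 h3. sw (\<delta> v) (\<lambda>g w.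
          F (h1 \<cdot> g \<cdot> S h3 \<cdot> h4) (h2 \<rhd> w)))))"
    by (simp add: coact_act sweedler lin_intros H.assoc)
  also have "\<dots> = sw (\<Delta> h) (\<lambda>h1 h'. sw (\<Delta> h') (\<lambda>h'' h4. sw (\<Delta> h'') (\<lambda>h2 h3. sw (\<delta> v) (\<lambda>g w.
          F (h1 \<cdot> g \<cdot> S h3 \<cdot> h4) (h2 \<rhd> w)))))"
    by (rule H.coassoc) (intro lin_intros)+
  also have "\<dots> = sw (\<Delta> h) (\<lambda>h1 h'. sw (\<Delta> h') (\<lambda>h2 h''. sw (\<Delta> h'') (\<lambda>h3 h4. sw (\<delta> v) (\<lambda>g w.
          F (h1 \<cdot> g \<cdot> S h3 \<cdot> h4) (h2 \<rhd> w)))))"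
    by (rule sw_cong, rule H.coassoc) (intro lin_intros)+
  also have "\<dots> = sw (\<Delta> h) (\<lambda>h1 h2. sw (\<delta> v) (\<lambda>g w. F (h1 \<cdot> g) (h2 \<rhd> w)))"
  proof -
    have "sw (\<Delta> h'') (\<lambda>h3 h4. sw (\<delta> v) (\<lambda>g w. F (h1 \<cdot> g \<cdot> S h3 \<cdot> h4) (h2 \<rhd> w)))
      = \<epsilon> h'' *s sw (\<delta> v) (\<lambda>g w. F (h1 \<cdot> g) (h2 \<rhd> w))" for h1 h2 h''
      by (rule trans, rule H.antipode_left[of "\<lambda>x. sw (\<delta> v) (\<lambda>g w. F (h1 \<cdot> g \<cdot> x) (h2 \<rhd> w))"])
        (simp_all add: lin_intros)
    moreover have "sw (\<Delta> h') (\<lambda>h2 h''. \<epsilon> h'' *s sw (\<delta> v) (\<lambda>g w. F (h1 \<cdot> g) (h2 \<rhd> w)))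
      = sw (\<delta> v) (\<lambda>g w. F (h1 \<cdot> g) (h' \<rhd> w))" for h1 h'
      by (rule H.counit_right) (intro lin_intros)
    ultimately show ?thesis by simp
  qed
  finally show ?thesis .
qed

text \<open>
  The braided algebra \<open>R \<otimes> R\<close> is a comodule algebra. In a product
  \<open>(a \<otimes> b) (c \<otimes> d)\<close> the coaction of \<open>b\<close> acts on \<open>c\<close>, and the Yetter-Drinfeld condition
  moves the coaction of the product past this action.
\<close>

lemma coact2_multRR: "coact2 H R (s \<bullet>\<^sub>2 t) =
  sw (coact2 H R s) (\<lambda>g s0. sw (coact2 H R t) (\<lambda>g' t0. (g \<cdot> g') \<otimes> (s0 \<bullet>\<^sub>2 t0)))"
proof (rule bilin_eqI[where s=s and t=t])
  fix a b c d
  define G where "G y z b00 = sw (\<delta> a) (\<lambda>ga a0. sw (\<delta> d) (\<lambda>gd d0.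
    (ga \<cdot> y \<cdot> gd) \<otimes> (a0 \<bullet> z) \<otimes> (b00 \<bullet> d0)))" for y z b00
  have lin_G: "lin (\<lambda>y. G y z b00)" "lin (\<lambda>z. G y z b00)" "lin (\<lambda>b00. G y z b00)" for y z b00
    unfolding G_def by (intro lin_intros)+
  note [lin_intros] = lin_comp[OF lin_G(1)] lin_comp[OF lin_G(2)] lin_comp[OF lin_G(3)]
  have "coact2 H R ((a \<otimes> b) \<bullet>\<^sub>2 (c \<otimes> d)) =
    sw (\<delta> b) (\<lambda>g b0. sw (\<delta> (g \<rhd> c)) (\<lambda>gc c0. sw (\<delta> b0) (\<lambda>gb b00. G (gc \<cdot> gb) c0 b00)))"
    by (simp add: multRR_tensor coact2_tensor coact_multR sweedler lin_intros H.assoc G_def)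
      (simp only: sw_commute[where s="\<delta> a"])
  also have "\<dots> = sw (\<delta> b) (\<lambda>g b0. sw (\<delta> b0) (\<lambda>gb b00. sw (\<delta> (g \<rhd> c)) (\<lambda>gc c0. G (gc \<cdot> gb) c0 b00)))"
    by (rule sw_cong, rule sw_commute)
  also have "\<dots> = sw (\<delta> b) (\<lambda>g' b00. sw (\<Delta> g') (\<lambda>g gb. sw (\<delta> (g \<rhd> c)) (\<lambda>gc c0. G (gc \<cdot> gb) c0 b00)))"
    by (rule coact_coassoc[symmetric]) (intro lin_intros)+
  also have "\<dots> = sw (\<delta> b) (\<lambda>g' b00. sw (\<Delta> g') (\<lambda>g gb. sw (\<delta> c) (\<lambda>gc c0. G (g \<cdot> gc) (gb \<rhd> c0) b00)))"
    by (subst yd_compat) (simp_all add: lin_intros)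
  also have "\<dots> = sw (\<delta> b) (\<lambda>g b0. sw (\<delta> b0) (\<lambda>gb b00. sw (\<delta> c) (\<lambda>gc c0. G (g \<cdot> gc) (gb \<rhd> c0) b00)))"
    by (rule coact_coassoc) (intro lin_intros)+
  also have "\<dots> = sw (coact2 H R (a \<otimes> b)) (\<lambda>g s0. sw (coact2 H R (c \<otimes> d)) (\<lambda>g' t0. (g \<cdot> g') \<otimes> (s0 \<bullet>\<^sub>2 t0)))"
    by (simp add: multRR_tensor coact2_tensor sweedler lin_intros H.assoc G_def)
      (simp only: sw_commute[where s="\<delta> c"], simp only: sw_commute[where s="\<delta> a"],
        simp only: sw_commute[where s="\<delta> d"])
  finally show "coact2 H R ((a \<otimes> b) \<bullet>\<^sub>2 (c \<otimes> d)) =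
    sw (coact2 H R (a \<otimes> b)) (\<lambda>g s0. sw (coact2 H R (c \<otimes> d)) (\<lambda>g' t0. (g \<cdot> g') \<otimes> (s0 \<bullet>\<^sub>2 t0)))" .
qed (intro lin_intros)+

section \<open>The bosonization as an algebra\<close>

lemma unitA: "\<one>\<^sub>A = \<one>\<^sub>R \<otimes> \<one>"
  by (simp add: bosonization_def)

lemma lin_multA [lin_intros]: "lin f \<Longrightarrow> lin (\<lambda>x. f x \<star> y)" "lin f \<Longrightarrow> lin (\<lambda>x. y \<star> f x)"
  and lin_comulA [lin_intros]: "lin f \<Longrightarrow> lin (\<lambda>x. \<Delta>\<^sub>A (f x))"
  unfolding bosonization_def by (simp, intro lin_intros, assumption)+

lemma multA_tensor: "(r \<otimes> h) \<star> (r' \<otimes> h') = sw (\<Delta> h) (\<lambda>h1 h2. (r \<bullet> (h1 \<rhd> r')) \<otimes> (h2 \<cdot> h'))"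
  unfolding bosonization_def by (simp add: sweedler lin_intros)

lemma multA_sw [sweedler]: "sw t b \<star> y = sw t (\<lambda>c d. b c d \<star> y)" "y \<star> sw t b = sw t (\<lambda>c d. y \<star> b c d)"
  by (rule lin_sw_apply, intro lin_intros)+

lemma multA_oneR: "(r \<otimes> g) \<star> (\<one>\<^sub>R \<otimes> h) = r \<otimes> (g \<cdot> h)"
  and multA_oneH: "(r \<otimes> \<one>) \<star> (s \<otimes> h) = (r \<bullet> s) \<otimes> h"
  by (simp_all add: multA_tensor sweedler lin_intros H.counit_left del: vec.scale_scale)

lemma multA_assoc: "(x \<star> y) \<star> z = x \<star> (y \<star> z)"
proof -
  have pure: "((r \<otimes> h) \<star> (r' \<otimes> h')) \<star> (r'' \<otimes> h'') = (r \<otimes> h) \<star> ((r' \<otimes> h') \<star> (r'' \<otimes> h''))" for r r' r'' h h' h''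
  proof -
    define G where "G h1 h2 h3 = sw (\<Delta> h') (\<lambda>c d.
      (r \<bullet> (h1 \<rhd> r') \<bullet> (h2 \<rhd> c \<rhd> r'')) \<otimes> (h3 \<cdot> d \<cdot> h''))" for h1 h2 h3
    have "((r \<otimes> h) \<star> (r' \<otimes> h')) \<star> (r'' \<otimes> h'') = sw (\<Delta> h) (\<lambda>h1 h'. sw (\<Delta> h') (\<lambda>h2 h3. G h1 h2 h3))"
      by (simp add: multA_tensor sweedler lin_intros H.comul_mult act_act R.assoc H.assoc G_def)
    also have "\<dots> = sw (\<Delta> h) (\<lambda>h' h3. sw (\<Delta> h') (\<lambda>h1 h2. G h1 h2 h3))"
      unfolding G_def by (rule H.coassoc[symmetric]) (intro lin_intros)+
    also have "\<dots> = (r \<otimes> h) \<star> ((r' \<otimes> h') \<star> (r'' \<otimes> h''))"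
      by (simp add: multA_tensor sweedler lin_intros act_multR act_act R.assoc H.assoc G_def)
        (simp only: sw_commute[where s="\<Delta> h'"])
    finally show ?thesis .
  qed
  show ?thesis
    by (rule lin_eqI[where t=z], (intro lin_intros)+, rule bilin_eqI[where s=x and t=y], (intro lin_intros)+)
      (rule pure)
qed

sublocale A: alg "mul A" "unit_el A"
proof
  show "bilin (mul A)"
    by (intro bilinI lin_intros)
  show "unit_el A \<star> x = x" for x
    by (rule lin_eqI[OF _ lin_id]) (simp_all add: lin_intros unitA multA_oneH)
  show "x \<star> unit_el A = x" for x
    by (rule lin_eqI[OF _ lin_id]) (simp_all add: lin_intros unitA multA_oneR)
qed (rule multA_assoc)

sublocale A2: alg "tensor_mul (mul A) (mul A)" "unit_el A \<otimes> unit_el A"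
  by (rule alg_tensor) unfold_locales

lemma multA2_tensor [simp, sweedler]: "(a \<otimes> b) \<star>\<^sub>2 (c \<otimes> d) = (a \<star> c) \<otimes> (b \<star> d)"
  by (rule tensor_mul_tensor) unfold_locales

lemma lin_iota [lin_intros]: "lin f \<Longrightarrow> lin (\<lambda>x. \<iota> (f x))"
  and lin_emb [lin_intros]: "lin g \<Longrightarrow> lin (\<lambda>x. emb (g x))"
  unfolding bos_twist_def embed2_def by (intro lin_intros, assumption)+

lemma iota_tensor: "\<iota> (r \<otimes> s) = sw (\<delta> s) (\<lambda>g s0. (r \<otimes> g) \<otimes> (s0 \<otimes> \<one>))"
  and emb_tensor [simp]: "emb (g \<otimes> h) = (\<one>\<^sub>R \<otimes> g) \<otimes> (\<one>\<^sub>R \<otimes> h)"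
  unfolding bos_twist_def embed2_def tmap_def by (simp_all add: sweedler lin_intros)

lemma iota_sw [sweedler]: "\<iota> (sw t b) = sw t (\<lambda>c d. \<iota> (b c d))"
  and emb_sw [sweedler]: "emb (sw t b') = sw t (\<lambda>c d. emb (b' c d))"
  by (rule lin_sw_apply, intro lin_intros)+

lemma emb_mult: "emb (H.mult2 s t) = emb s \<star>\<^sub>2 emb t"
  by (rule bilin_eqI) (simp_all add: lin_intros multA_oneR)

lemma emb_one [simp]: "emb (\<one> \<otimes> \<one>) = \<one>\<^sub>A \<otimes> \<one>\<^sub>A"
  by (simp add: unitA)

lemma iota_one [simp]: "\<iota> (\<one>\<^sub>R \<otimes> \<one>\<^sub>R) = \<one>\<^sub>A \<otimes> \<one>\<^sub>A"
  by (simp add: iota_tensor unitA sweedler lin_intros)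

text \<open>
  In \<open>(r # s\<^sub>(\<^sub>-\<^sub>1\<^sub>)) (r' # s'\<^sub>(\<^sub>-\<^sub>1\<^sub>))\<close> one part of the coaction of \<open>s\<close> acts on \<open>r'\<close> and another part
  multiplies \<open>s'\<^sub>(\<^sub>-\<^sub>1\<^sub>)\<close>. By coassociativity of the coaction the former is the braiding in the
  product of \<open>R \<otimes> R\<close>, the latter the coaction of \<open>s\<^sub>(\<^sub>0\<^sub>) s'\<close>.
\<close>

lemma iota_mult: "\<iota> (s \<bullet>\<^sub>2 t) = \<iota> s \<star>\<^sub>2 \<iota> t"
proof (rule bilin_eqI[where s=s and t=t])
  fix r s r' s'
  define G where "G a b s0 = sw (\<delta> s') (\<lambda>g' s0'. ((r \<bullet> (a \<rhd> r')) \<otimes> (b \<cdot> g')) \<otimes> ((s0 \<bullet> s0') \<otimes> \<one>))" for a b s0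
  have "\<iota> ((r \<otimes> s) \<bullet>\<^sub>2 (r' \<otimes> s')) = sw (\<delta> s) (\<lambda>a s'. sw (\<delta> s') (\<lambda>b s0. G a b s0))"
    by (simp add: multRR_tensor iota_tensor coact_multR sweedler lin_intros G_def)
  also have "\<dots> = sw (\<delta> s) (\<lambda>g s0. sw (\<Delta> g) (\<lambda>a b. G a b s0))"
    unfolding G_def by (rule coact_coassoc[symmetric]) (intro lin_intros)+
  also have "\<dots> = \<iota> (r \<otimes> s) \<star>\<^sub>2 \<iota> (r' \<otimes> s')"
    by (simp add: iota_tensor multA_tensor sweedler lin_intros multA_oneH G_def)
      (simp only: sw_commute[where s="\<delta> s'"])
  finally show "\<iota> ((r \<otimes> s) \<bullet>\<^sub>2 (r' \<otimes> s')) = \<iota> (r \<otimes> s) \<star>\<^sub>2 \<iota> (r' \<otimes> s')" .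
qed (intro lin_intros)+

text \<open>
  Applying the counit of \<open>H\<close> to both \<open>H\<close>-components is a left inverse of \<open>\<iota>\<close>.
\<close>

lemma iota_inj: "inj \<iota>"
proof -
  define p where "p t = sw t (\<lambda>x y. sw x (\<lambda>r g. sw y (\<lambda>s h. (\<epsilon> g * \<epsilon> h) *s (r \<otimes> s))))" for t :: "'k ^ (('r \<times> 'h) \<times> ('r \<times> 'h))"
  have "p (\<iota> t) = t" for t
  proof (rule lin_eqI[OF _ lin_id])
    show "p (\<iota> (r \<otimes> s)) = r \<otimes> s" for r s
      using counit_coact[of "\<lambda>s. r \<otimes> s"] unfolding p_def by (simp add: iota_tensor sweedler lin_intros)
  qed (unfold p_def, intro lin_intros)
  then show ?thesis
    by (rule inj_on_inverseI)
qed

text \<open>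
  The braided product is associative because \<open>\<iota>\<close> embeds it into \<open>A \<otimes> A\<close>. In particular
  inverses for it are unique.
\<close>

sublocale RR: alg "braided_mul R" "unit_el R \<otimes> unit_el R"
proof
  show "bilin (braided_mul R)"
    by (intro bilinI lin_intros)
  show "(x \<bullet>\<^sub>2 y) \<bullet>\<^sub>2 z = x \<bullet>\<^sub>2 (y \<bullet>\<^sub>2 z)" "(\<one>\<^sub>R \<otimes> \<one>\<^sub>R) \<bullet>\<^sub>2 x = x" "x \<bullet>\<^sub>2 (\<one>\<^sub>R \<otimes> \<one>\<^sub>R) = x" for x y z
    by (rule injD[OF iota_inj], simp add: iota_mult A2.assoc)+
qed

section \<open>The coproduct of the bosonization\<close>

text \<open>
  The left side is the expression that defines the coproduct of a bosonization, with an arbitrary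
  tensor in place of the coproduct of \<open>R\<close>. In this generality the formula also describes the
  coproduct of the bosonization of a twisted \<open>R\<close>.
\<close>

lemma iota_emb: "sw t (\<lambda>r s. sw (\<delta> s) (\<lambda>g s0. sw (\<Delta> h) (\<lambda>h1 h2. (r \<otimes> (g \<cdot> h1)) \<otimes> (s0 \<otimes> h2)))) = \<iota> t \<star>\<^sub>2 emb (\<Delta> h)"
proof (rule lin_eqI[where t=t])
  fix r s
  show "sw (r \<otimes> s) (\<lambda>r s. sw (\<delta> s) (\<lambda>g s0. sw (\<Delta> h) (\<lambda>h1 h2. (r \<otimes> (g \<cdot> h1)) \<otimes> (s0 \<otimes> h2)))) = \<iota> (r \<otimes> s) \<star>\<^sub>2 emb (\<Delta> h)"
    unfolding embed2_def tmap_def by (simp add: iota_tensor sweedler lin_intros multA_oneR)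
      (rule sw_commute)
qed (intro lin_intros)+

lemma comulA_tensor: "\<Delta>\<^sub>A (r \<otimes> h) = \<iota> (\<Delta>\<^sub>R r) \<star>\<^sub>2 emb (\<Delta> h)"
  unfolding iota_emb[symmetric] by (simp add: bosonization_def sweedler lin_intros)

lemma comulA_R: "\<Delta>\<^sub>A (r \<otimes> \<one>) = \<iota> (\<Delta>\<^sub>R r)"
  and comulA_H: "\<Delta>\<^sub>A (\<one>\<^sub>R \<otimes> h) = emb (\<Delta> h)"
  by (simp_all add: comulA_tensor del: emb_tensor)

text \<open>
  This is where the Yetter-Drinfeld condition enters the bosonization: both sides are evaluations
  of a fourfold coproduct of \<open>h\<close>, and they differ by that condition on the two middle legs.
\<close>

lemma emb_iota: "emb (\<Delta> h) \<star>\<^sub>2 \<iota> t = sw (\<Delta> h) (\<lambda>h1 h2. \<iota> (act2 H R h1 t) \<star>\<^sub>2 emb (\<Delta> h2))"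
proof (rule lin_eqI[where t=t])
  fix r s
  have "emb (\<Delta> h) \<star>\<^sub>2 \<iota> (r \<otimes> s) = sw (\<Delta> h) (\<lambda>x y. sw (\<Delta> y) (\<lambda>c d. sw (\<Delta> x) (\<lambda>a b.
      sw (\<delta> s) (\<lambda>g s0. ((a \<rhd> r) \<otimes> (b \<cdot> g)) \<otimes> ((c \<rhd> s0) \<otimes> d)))))"
    unfolding embed2_def tmap_def by (simp add: iota_tensor sweedler lin_intros multA_tensor)
      (simp only: sw_commute[where s="\<delta> s"])
  also have "\<dots> = sw (\<Delta> h) (\<lambda>x y. sw (\<Delta> x) (\<lambda>a b. sw (\<Delta> y) (\<lambda>c d.
      sw (\<delta> s) (\<lambda>g s0. ((a \<rhd> r) \<otimes> (b \<cdot> g)) \<otimes> ((c \<rhd> s0) \<otimes> d)))))"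
    by (rule sw_cong, rule sw_commute)
  also have "\<dots> = sw (\<Delta> h) (\<lambda>a x. sw (\<Delta> x) (\<lambda>y d. sw (\<Delta> y) (\<lambda>b c.
      sw (\<delta> s) (\<lambda>g s0. ((a \<rhd> r) \<otimes> (b \<cdot> g)) \<otimes> ((c \<rhd> s0) \<otimes> d)))))"
    by (rule H.coassoc_balanced) (intro lin_intros)+
  also have "\<dots> = sw (\<Delta> h) (\<lambda>a x. sw (\<Delta> x) (\<lambda>y d. sw (\<Delta> y) (\<lambda>b c.
      sw (\<delta> (b \<rhd> s)) (\<lambda>g s0. ((a \<rhd> r) \<otimes> (g \<cdot> c)) \<otimes> (s0 \<otimes> d)))))"
    by (intro sw_cong yd_compat[symmetric] lin_intros)
  also have "\<dots> = sw (\<Delta> h) (\<lambda>x y. sw (\<Delta> x) (\<lambda>a b. sw (\<Delta> y) (\<lambda>c d.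
      sw (\<delta> (b \<rhd> s)) (\<lambda>g s0. ((a \<rhd> r) \<otimes> (g \<cdot> c)) \<otimes> (s0 \<otimes> d)))))"
    by (rule H.coassoc_balanced[symmetric]) (intro lin_intros)+
  also have "\<dots> = sw (\<Delta> h) (\<lambda>h1 h2. \<iota> (act2 H R h1 (r \<otimes> s)) \<star>\<^sub>2 emb (\<Delta> h2))"
    unfolding iota_emb[symmetric]
    by (simp add: sweedler lin_intros act2_tensor) (rule sw_cong, rule sw_cong, rule sw_commute)
  finally show "emb (\<Delta> h) \<star>\<^sub>2 \<iota> (r \<otimes> s) = sw (\<Delta> h) (\<lambda>h1 h2. \<iota> (act2 H R h1 (r \<otimes> s)) \<star>\<^sub>2 emb (\<Delta> h2))" .
qed (intro lin_intros)+

lemma emb_iota_assoc: "emb (\<Delta> h) \<star>\<^sub>2 \<iota> t \<star>\<^sub>2 y = sw (\<Delta> h) (\<lambda>h1 h2. \<iota> (act2 H R h1 t) \<star>\<^sub>2 emb (\<Delta> h2) \<star>\<^sub>2 y)"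
  unfolding A2.assoc[symmetric] emb_iota by (simp add: tensor_mul_sw_left)

lemma counitA_tensor: "counit A (r \<otimes> h) = \<epsilon>\<^sub>R r * \<epsilon> h"
  unfolding bosonization_def by (simp add: sweedler lin_intros H.counit_scale)

lemma lin_form_counitA: "lin_form (counit A)"
  unfolding bosonization_def by (simp, intro lin_intros)

end

text \<open>
  Multiplicativity of the coproduct: in
  \<open>\<Delta>(r # h) \<Delta>(r' # h') = \<iota>(\<Delta>(r)) \<Delta>(h) \<iota>(\<Delta>(r')) \<Delta>(h')\<close> the lemma \<open>emb_iota\<close> exchanges the two middle
  factors, after which \<open>\<iota>\<close> and the inclusion of \<open>H \<otimes> H\<close> are multiplicative.
\<close>

sublocale yd \<subseteq> A: prebialg "bosonization H R"
proof (intro prebialg.intro precoalg.intro prebialg_axioms.intro A.alg_axioms)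
  show "lin \<Delta>\<^sub>A" by (intro lin_intros)
  show "lin_form (counit A)" by (rule lin_form_counitA)
  show "\<Delta>\<^sub>A (x \<star> y) = \<Delta>\<^sub>A x \<star>\<^sub>2 \<Delta>\<^sub>A y" for x y
  proof (rule bilin_eqI[where s=x and t=y])
    show "\<Delta>\<^sub>A ((r \<otimes> h) \<star> (r' \<otimes> h')) = \<Delta>\<^sub>A (r \<otimes> h) \<star>\<^sub>2 \<Delta>\<^sub>A (r' \<otimes> h')" for r h r' h'
      unfolding multA_tensor comulA_tensor lin_sw_apply[OF lin_comulA[OF lin_id]]
      by (simp add: comul_multR comul_act iota_mult H.comul_mult_tensor_mul emb_mult A2.assoc emb_iota_assoc
          flip: tensor_mul_sw_right)
  qed (intro lin_intros)+
  show "\<Delta>\<^sub>A \<one>\<^sub>A = \<one>\<^sub>A \<otimes> \<one>\<^sub>A"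
    by (simp add: unitA comulA_R)
  have eq: "counit A ((r \<otimes> h) \<star> (r' \<otimes> h')) = counit A (r \<otimes> h) * counit A (r' \<otimes> h')" for r h r' h'
  proof -
    have "counit A ((r \<otimes> h) \<star> (r' \<otimes> h')) *s (1 :: 'k ^ 1) = (\<epsilon>\<^sub>R r * \<epsilon>\<^sub>R r' * \<epsilon> h') *s sw (\<Delta> h) (\<lambda>h1 h2. \<epsilon> h1 *s (\<epsilon> h2 *s 1))"
      unfolding multA_tensor lin_form_sw_apply[OF lin_form_counitA] sw_scale[symmetric]
      by (simp add: counitA_tensor algebra_simps)
    also have "sw (\<Delta> h) (\<lambda>h1 h2. \<epsilon> h1 *s (\<epsilon> h2 *s 1)) = \<epsilon> h *s (1 :: 'k ^ 1)"
      by (rule H.counit_left) (intro lin_intros)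
    finally show ?thesis
      by (simp add: vec_eq_iff counitA_tensor algebra_simps)
  qed
  note [lin_intros] = lin_form_comp[OF lin_form_counitA]
  show "counit A (x \<star> y) = counit A x * counit A y" for x y
    by (rule lin_form_eqI[where t=x], (intro lin_intros)+, rule lin_form_eqI[where t=y], (intro lin_intros)+, rule eq)
  show "counit A \<one>\<^sub>A = 1"
    by (simp add: unitA counitA_tensor)
qed

context yd
begin

text \<open>
  The analogue of \<open>\<iota>\<close> for three factors is
  \<open>r \<otimes> s \<otimes> t \<mapsto> r # s\<^sub>(\<^sub>-\<^sub>1\<^sub>) t\<^sub>(\<^sub>-\<^sub>2\<^sub>) \<otimes> s\<^sub>(\<^sub>0\<^sub>) # t\<^sub>(\<^sub>-\<^sub>1\<^sub>) \<otimes> t\<^sub>(\<^sub>0\<^sub>) # 1\<close>. It has two factorizations through \<open>\<iota>\<close>,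
  according to which neighbouring factors are grouped. They agree by coassociativity of the
  coaction (\<open>iota3_right_tensor\<close>), and each of them is adapted to the coproduct on one leg.
\<close>

definition iota3_right where "iota3_right (r :: 'k ^ 'r) T = sw (coact2 H R T) (\<lambda>g T0. (r \<otimes> g) \<otimes> \<iota> T0)"
definition iota3_left where "iota3_left T s = sw (\<delta> s) (\<lambda>g s0. tassoc ((\<iota> T \<star>\<^sub>2 emb (\<Delta> g)) \<otimes> (s0 \<otimes> \<one>)))"
definition iota3 where "iota3 w = sw w iota3_right"

lemma lin_iota3 [lin_intros]: "lin f \<Longrightarrow> lin (\<lambda>x. iota3_right (f x) T)" "lin g \<Longrightarrow> lin (\<lambda>x. iota3_right r (g x))"
  "lin g \<Longrightarrow> lin (\<lambda>x. iota3_left (g x) s)" "lin f \<Longrightarrow> lin (\<lambda>x. iota3_left T (f x))" "lin i \<Longrightarrow> lin (\<lambda>x. iota3 (i x))"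
  unfolding iota3_right_def iota3_left_def iota3_def by (intro lin_intros, assumption)+

lemma iota3_tensor: "iota3 (r \<otimes> T) = iota3_right r T"
  unfolding iota3_def by (simp add: sweedler lin_intros)

lemma iota3_right_tensor: "iota3_right r (s \<otimes> t) = iota3_left (r \<otimes> s) t"
proof -
  define G where "G a (b :: 'k ^ 'h) (t0 :: 'k ^ 'r) = sw (\<delta> s) (\<lambda>g s0. (r \<otimes> (g \<cdot> a)) \<otimes> (s0 \<otimes> b) \<otimes> (t0 \<otimes> \<one>))" for a b t0
  have "iota3_right r (s \<otimes> t) = sw (\<delta> t) (\<lambda>a t'. sw (\<delta> t') (\<lambda>b t0. G a b t0))"
    by (simp add: iota3_right_def coact2_tensor iota_tensor sweedler lin_intros G_def)
      (simp only: sw_commute[where s="\<delta> s"])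
  also have "\<dots> = sw (\<delta> t) (\<lambda>g t0. sw (\<Delta> g) (\<lambda>a b. G a b t0))"
    unfolding G_def by (rule coact_coassoc[symmetric]) (intro lin_intros)+
  also have "\<dots> = iota3_left (r \<otimes> s) t"
    by (simp add: iota3_left_def iota_emb[symmetric] sweedler lin_intros G_def)
      (simp only: sw_commute[where s="\<delta> s"])
  finally show ?thesis .
qed

lemma iota3_tassoc: "iota3 (tassoc (T \<otimes> s)) = iota3_left T s"
  by (rule lin_eqI) (simp_all add: lin_intros tassoc_tensor iota3_tensor iota3_right_tensor)

lemma comul_snd_iota: "A.comul_snd (\<iota> t) = iota3 (tmap id \<Delta>\<^sub>R t)"
proof (rule lin_eqI[where t=t])
  fix r s
  have "A.comul_snd (\<iota> (r \<otimes> s)) = sw (\<delta> s) (\<lambda>g s0. (r \<otimes> g) \<otimes> \<iota> (\<Delta>\<^sub>R s0))"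
    by (simp add: iota_tensor lin_sw_apply[OF A.lin_comul_legs(2)[OF lin_id]] A.comul_snd_tensor comulA_R)
  also have "\<dots> = iota3_right r (\<Delta>\<^sub>R s)"
    by (simp add: iota3_right_def coact2_comul tmap_def sweedler lin_intros)
  finally show "A.comul_snd (\<iota> (r \<otimes> s)) = iota3 (tmap id \<Delta>\<^sub>R (r \<otimes> s))"
    by (simp add: tmap_tensor vec.linear_id R.lin_comul_map iota3_tensor)
qed (intro lin_intros)+

lemma comul_fst_iota: "A.comul_fst (\<iota> t) = iota3 (tassoc (tmap \<Delta>\<^sub>R id t))"
proof (rule lin_eqI[where t=t])
  fix r s
  show "A.comul_fst (\<iota> (r \<otimes> s)) = iota3 (tassoc (tmap \<Delta>\<^sub>R id (r \<otimes> s)))"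
    by (simp add: iota_tensor lin_sw_apply[OF A.lin_comul_legs(1)[OF lin_id]] A.comul_fst_tensor comulA_tensor
      tmap_tensor vec.linear_id R.lin_comul_map iota3_tassoc iota3_left_def)
qed (intro lin_intros)+

text \<open>
  Coassociativity of \<open>R\<close>, transported by \<open>iota3\<close>.
\<close>

lemma coassoc_iota: "A.comul_fst (\<iota> (\<Delta>\<^sub>R r)) = A.comul_snd (\<iota> (\<Delta>\<^sub>R r))"
  by (simp add: comul_fst_iota comul_snd_iota R.coassoc_tmap)

lemma coassoc_emb: "A.comul_fst (emb (\<Delta> h)) = A.comul_snd (emb (\<Delta> h))"
proof -
  have "A.comul_fst (emb (\<Delta> h)) = sw (\<Delta> h) (\<lambda>x c. sw (\<Delta> x) (\<lambda>a b. (\<one>\<^sub>R \<otimes> a) \<otimes> (\<one>\<^sub>R \<otimes> b) \<otimes> (\<one>\<^sub>R \<otimes> c)))"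
    by (subst (1) embed2_def, subst (1) tmap_def)
      (simp add: lin_sw_apply[OF A.lin_comul_legs(1)[OF lin_id]] A.comul_fst_tensor comulA_H embed2_def tmap_def sweedler lin_intros)
  also have "\<dots> = sw (\<Delta> h) (\<lambda>a x. sw (\<Delta> x) (\<lambda>b c. (\<one>\<^sub>R \<otimes> a) \<otimes> (\<one>\<^sub>R \<otimes> b) \<otimes> (\<one>\<^sub>R \<otimes> c)))"
    by (rule H.coassoc) (intro lin_intros)+
  also have "\<dots> = A.comul_snd (emb (\<Delta> h))"
    by (subst (1) embed2_def, subst (1) tmap_def)
      (simp add: lin_sw_apply[OF A.lin_comul_legs(2)[OF lin_id]] A.comul_snd_tensor comulA_H embed2_def tmap_def sweedler lin_intros)
  finally show ?thesis .
qed

lemma counit_fst_iota: "A.counit_fst (\<iota> t) = sw t (\<lambda>a b. \<epsilon>\<^sub>R a *s b) \<otimes> \<one>"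
  and counit_snd_iota: "A.counit_snd (\<iota> t) = sw t (\<lambda>a b. \<epsilon>\<^sub>R b *s a) \<otimes> \<one>"
proof -
  have "A.counit_fst (\<iota> (r \<otimes> s)) = \<epsilon>\<^sub>R r *s (s \<otimes> \<one>)" for r s
    using counit_coact[of "\<lambda>s. s \<otimes> \<one>" s]
    by (simp add: iota_tensor lin_sw_apply[OF A.lin_counit_legs(1)[OF lin_id]] counitA_tensor lin_intros
      sw_scale flip: vec.scale_scale del: vec.scale_scale)
  note eq = this
  show "A.counit_fst (\<iota> t) = sw t (\<lambda>a b. \<epsilon>\<^sub>R a *s b) \<otimes> \<one>"
    by (rule lin_eqI[where t=t]) (simp_all add: eq sweedler lin_intros)
  have "A.counit_snd (\<iota> (r \<otimes> s)) = \<epsilon>\<^sub>R s *s (r \<otimes> \<one>)" for r s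
    using counitR_coact[of "\<lambda>g. r \<otimes> g" s]
    by (simp add: iota_tensor lin_sw_apply[OF A.lin_counit_legs(2)[OF lin_id]] counitA_tensor lin_intros)
  note eq = this
  show "A.counit_snd (\<iota> t) = sw t (\<lambda>a b. \<epsilon>\<^sub>R b *s a) \<otimes> \<one>"
    by (rule lin_eqI[where t=t]) (simp_all add: eq sweedler lin_intros)
qed

lemma counit_legs_emb: "A.counit_fst (emb t) = \<one>\<^sub>R \<otimes> H.counit_fst t" "A.counit_snd (emb t) = \<one>\<^sub>R \<otimes> H.counit_snd t"
  by (rule lin_eqI[where t=t]; simp add: lin_intros counitA_tensor sweedler)+

end

text \<open>
  All maps in the coalgebra axioms are algebra homomorphisms when composed with the coproduct, so
  the axioms for \<open>r # h = (r # 1) (1 # h)\<close> follow from those for the two factors.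
\<close>

sublocale yd \<subseteq> A: bialg "bosonization H R"
proof
  have "A.comul_fst (\<Delta>\<^sub>A (r \<otimes> h)) = A.comul_snd (\<Delta>\<^sub>A (r \<otimes> h))" for r h
    by (simp add: comulA_tensor A.comul_fst_mult A.comul_snd_mult coassoc_iota coassoc_emb)
  then have "A.comul_fst (\<Delta>\<^sub>A x) = A.comul_snd (\<Delta>\<^sub>A x)" for x
    by (rule lin_eqI[where t=x, rotated 2]) (intro lin_intros)+
  then show "tassoc (tmap \<Delta>\<^sub>A id (\<Delta>\<^sub>A x)) = tmap id \<Delta>\<^sub>A (\<Delta>\<^sub>A x)" for x
    by (simp add: A.comul_fst_def A.comul_snd_def)
  have 1: "A.counit_fst (\<Delta>\<^sub>A (r \<otimes> h)) = r \<otimes> h" "A.counit_snd (\<Delta>\<^sub>A (r \<otimes> h)) = r \<otimes> h" for r h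
    by (simp_all add: comulA_tensor A.counit_fst_mult A.counit_snd_mult counit_fst_iota counit_snd_iota counit_legs_emb
        R.counit_left_id R.counit_right_id multA_oneR)
  have "A.counit_fst (\<Delta>\<^sub>A x) = x" for x
    by (rule lin_eqI[where t=x]) (simp_all add: lin_intros 1)
  then show "sw (\<Delta>\<^sub>A x) (\<lambda>a b. counit A a *s b) = x" for x
    by (simp add: A.counit_fst_def)
  have "A.counit_snd (\<Delta>\<^sub>A x) = x" for x
    by (rule lin_eqI[where t=x]) (simp_all add: lin_intros 1)
  then show "sw (\<Delta>\<^sub>A x) (\<lambda>a b. counit A b *s a) = x" for x
    by (simp add: A.counit_snd_def)
qed

context yd
begin

section \<open>The antipode of the bosonization\<close>

definition SR where "SR = (SOME T. is_antipode R T \<and> bij T)"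

lemma SR: "is_antipode R SR" "bij SR"
proof -
  have "\<exists>T. is_antipode R T \<and> bij T"
    using yd by (auto simp: yd_hopf_algebra_def)
  from someI_ex[OF this] show "is_antipode R SR" "bij SR"
    by (simp_all add: SR_def)
qed

lemma lin_SR [lin_intros]: "lin f \<Longrightarrow> lin (\<lambda>x. SR (f x))"
  using SR lin_comp[of SR] by (simp add: is_antipode_def)

lemma lin_inv_SR [lin_intros]: "lin f \<Longrightarrow> lin (\<lambda>x. inv SR (f x))"
proof -
  have "inv SR x = y \<longleftrightarrow> x = SR y" for x y
    using SR(2) by (metis bij_inv_eq_iff)
  then have "lin (inv SR)"
    using SR(2) lin_SR[OF lin_id] unfolding lin_iff by (simp add: bij_is_surj surj_f_inv_f)
  then show "lin f \<Longrightarrow> lin (\<lambda>x. inv SR (f x))" by (rule lin_comp)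
qed

lemma SR_left: "sw (\<Delta>\<^sub>R r) (\<lambda>a b. SR a \<bullet> b) = \<epsilon>\<^sub>R r *s \<one>\<^sub>R"
  and SR_right: "sw (\<Delta>\<^sub>R r) (\<lambda>a b. a \<bullet> SR b) = \<epsilon>\<^sub>R r *s \<one>\<^sub>R"
  using SR by (simp_all add: is_antipode_def)

text \<open>
  The antipode \<open>r # h \<mapsto> (1 # S(r\<^sub>(\<^sub>-\<^sub>1\<^sub>) h)) (S(r\<^sub>(\<^sub>0\<^sub>)) # 1)\<close>.
\<close>

definition SA where "SA x = sw x (\<lambda>r h. sw (\<delta> r) (\<lambda>g r0. (\<one>\<^sub>R \<otimes> S (g \<cdot> h)) \<star> (SR r0 \<otimes> \<one>)))"

lemma lin_SA [lin_intros]: "lin f \<Longrightarrow> lin (\<lambda>x. SA (f x))"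
  unfolding SA_def by (intro lin_intros)

lemma SA_tensor: "SA (r \<otimes> h) = sw (\<delta> r) (\<lambda>g r0. (\<one>\<^sub>R \<otimes> S (g \<cdot> h)) \<star> (SR r0 \<otimes> \<one>))"
  unfolding SA_def by (simp add: sweedler lin_intros)

lemma comulA_explicit: "\<Delta>\<^sub>A (r \<otimes> h) = sw (\<Delta>\<^sub>R r) (\<lambda>r1 r2. sw (\<delta> r2) (\<lambda>g r20. sw (\<Delta> h) (\<lambda>h1 h2.
    (r1 \<otimes> (g \<cdot> h1)) \<otimes> (r20 \<otimes> h2))))"
  unfolding comulA_tensor iota_emb[symmetric] ..

text \<open>
  The two coactions that occur combine to the coaction of \<open>\<Delta>(r)\<close> in \<open>R \<otimes> R\<close>. As \<open>\<Delta>\<close> is colinear,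
  the antipode of \<open>R\<close> cancels first, then the one of \<open>H\<close>.
\<close>

lemma SA_left: "sw (\<Delta>\<^sub>A (r \<otimes> h)) (\<lambda>a b. SA a \<star> b) = (\<epsilon>\<^sub>R r * \<epsilon> h) *s \<one>\<^sub>A"
proof -
  define F where "F q T = sw (\<Delta> h) (\<lambda>h1 h2. (\<one>\<^sub>R \<otimes> S (q \<cdot> h1)) \<star> (sw T (\<lambda>a b. SR a \<bullet> b) \<otimes> h2))" for q T
  have lin_F: "lin (\<lambda>q. F q T)" "lin (\<lambda>T. F q T)" for q T
    unfolding F_def by (intro lin_intros)+
  have F: "F q (a \<otimes> b) = sw (\<Delta> h) (\<lambda>h1 h2. (\<one>\<^sub>R \<otimes> S (q \<cdot> h1)) \<star> ((SR a \<bullet> b) \<otimes> h2))" for q a b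
    unfolding F_def by (simp add: sw_tensor_lin lin_intros)
  have "sw (\<Delta>\<^sub>A (r \<otimes> h)) (\<lambda>a b. SA a \<star> b) =
    sw (\<Delta>\<^sub>R r) (\<lambda>r1 r2. sw (\<delta> r2) (\<lambda>g r20. sw (\<delta> r1) (\<lambda>k r10. F (k \<cdot> g) (r10 \<otimes> r20))))"
    unfolding comulA_explicit F
    by (simp add: sw_sw sw_tensor_lin multA_sw lin_intros SA_tensor A.assoc multA_oneH H.assoc)
      (simp only: sw_commute[where s="\<Delta> h"])
  also have "\<dots> = sw (\<Delta>\<^sub>R r) (\<lambda>r1 r2. sw (\<delta> r1) (\<lambda>k r10. sw (\<delta> r2) (\<lambda>g r20. F (k \<cdot> g) (r10 \<otimes> r20))))"
    by (rule sw_cong, rule sw_commute)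
  also have "\<dots> = sw (coact2 H R (\<Delta>\<^sub>R r)) F"
    unfolding coact2_def by (simp add: sw_sw sw_tensor_lin lin_F)
  also have "\<dots> = sw (\<delta> r) (\<lambda>q r0. \<epsilon>\<^sub>R r0 *s sw (\<Delta> h) (\<lambda>h1 h2. \<one>\<^sub>R \<otimes> (S (q \<cdot> h1) \<cdot> h2)))"
    unfolding coact2_comul tmap_def
    by (simp add: sweedler lin_F lin_intros) (simp add: F_def SR_left sweedler A.mult_scale_right multA_oneR)
  also have "\<dots> = \<epsilon>\<^sub>R r *s sw (\<Delta> h) (\<lambda>h1 h2. \<one>\<^sub>R \<otimes> (S h1 \<cdot> h2))"
    by (rule trans, rule counitR_coact) (simp_all add: lin_intros)
  also have "sw (\<Delta> h) (\<lambda>h1 h2. \<one>\<^sub>R \<otimes> (S h1 \<cdot> h2)) = \<epsilon> h *s \<one>\<^sub>A"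
    unfolding unitA by (rule H.antipode_left) (intro lin_intros)
  finally show ?thesis by simp
qed

text \<open>
  Here the antipode of \<open>H\<close> cancels twice, against the coproduct of \<open>h\<close> and against the twofold
  coaction, before the antipode of \<open>R\<close> does.
\<close>

lemma SA_right: "sw (\<Delta>\<^sub>A (r \<otimes> h)) (\<lambda>a b. a \<star> SA b) = (\<epsilon>\<^sub>R r * \<epsilon> h) *s \<one>\<^sub>A"
proof -
  have 1: "sw (\<Delta> h) (\<lambda>h1 h2. (r1 \<otimes> (g \<cdot> h1)) \<star> (\<one>\<^sub>R \<otimes> S (k \<cdot> h2)) \<star> y) = \<epsilon> h *s ((r1 \<otimes> (g \<cdot> S k)) \<star> y)" for r1 g k y
  proof -
    have "sw (\<Delta> h) (\<lambda>h1 h2. (r1 \<otimes> (g \<cdot> h1)) \<star> (\<one>\<^sub>R \<otimes> S (k \<cdot> h2)) \<star> y)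
      = sw (\<Delta> h) (\<lambda>h1 h2. (r1 \<otimes> (g \<cdot> (h1 \<cdot> S h2) \<cdot> S k)) \<star> y)"
      by (simp add: multA_oneR H.antipode_mult H.assoc flip: A.assoc)
    also have "\<dots> = \<epsilon> h *s ((r1 \<otimes> (g \<cdot> \<one> \<cdot> S k)) \<star> y)"
      by (rule H.antipode_right[of "\<lambda>x. (r1 \<otimes> (g \<cdot> x \<cdot> S k)) \<star> y"]) (intro lin_intros)
    finally show ?thesis by simp
  qed
  have 2: "sw (\<delta> s) (\<lambda>g s0. sw (\<delta> s0) (\<lambda>k s00. (r1 \<otimes> (g \<cdot> S k)) \<star> (SR s00 \<otimes> \<one>))) = (r1 \<bullet> SR s) \<otimes> \<one>" for r1 s
  proof -
    have "sw (\<delta> s) (\<lambda>g s0. sw (\<delta> s0) (\<lambda>k s00. (r1 \<otimes> (g \<cdot> S k)) \<star> (SR s00 \<otimes> \<one>)))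
      = sw (\<delta> s) (\<lambda>q s0. sw (\<Delta> q) (\<lambda>g k. (r1 \<otimes> (g \<cdot> S k)) \<star> (SR s0 \<otimes> \<one>)))"
      by (rule coact_coassoc[symmetric]) (intro lin_intros)+
    also have "\<dots> = sw (\<delta> s) (\<lambda>q s0. \<epsilon> q *s ((r1 \<bullet> SR s0) \<otimes> \<one>))"
      by (rule sw_cong, subst H.antipode_right[of "\<lambda>x. (r1 \<otimes> x) \<star> _"]) (simp_all add: lin_intros multA_oneH)
    also have "\<dots> = (r1 \<bullet> SR s) \<otimes> \<one>"
      by (rule counit_coact) (intro lin_intros)
    finally show ?thesis .
  qed
  have "sw (\<Delta>\<^sub>A (r \<otimes> h)) (\<lambda>a b. a \<star> SA b) = sw (\<Delta>\<^sub>R r) (\<lambda>r1 r2. sw (\<delta> r2) (\<lambda>g r20. sw (\<delta> r20) (\<lambda>k r200.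
      sw (\<Delta> h) (\<lambda>h1 h2. (r1 \<otimes> (g \<cdot> h1)) \<star> (\<one>\<^sub>R \<otimes> S (k \<cdot> h2)) \<star> (SR r200 \<otimes> \<one>)))))"
    unfolding comulA_explicit
    by (simp add: sw_sw sw_tensor_lin tensor_sw_left tensor_sw_right multA_sw lin_intros SA_tensor)
      (simp only: sw_commute[where s="\<Delta> h"])
  also have "\<dots> = sw (\<Delta>\<^sub>R r) (\<lambda>r1 r2. \<epsilon> h *s ((r1 \<bullet> SR r2) \<otimes> \<one>))"
    unfolding 1 sw_scale 2 ..
  also have "\<dots> = (\<epsilon>\<^sub>R r * \<epsilon> h) *s \<one>\<^sub>A"
    by (simp add: sw_scale SR_right unitA sweedler mult.commute flip: tensor_sw_left)
  finally show ?thesis .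
qed

lemma is_antipode_SA: "is_antipode A SA"
  unfolding is_antipode_def
proof (intro conjI allI)
  show "lin SA" by (intro lin_intros)
  show "sw (\<Delta>\<^sub>A x) (\<lambda>a b. SA a \<star> b) = counit A x *s \<one>\<^sub>A" for x
    by (rule lin_eqI[where t=x]) (simp_all add: lin_intros SA_left counitA_tensor)
  show "sw (\<Delta>\<^sub>A x) (\<lambda>a b. a \<star> SA b) = counit A x *s \<one>\<^sub>A" for x
    by (rule lin_eqI[where t=x]) (simp_all add: lin_intros SA_right counitA_tensor)
qed

text \<open>
  The antipode is the composite of \<open>\<theta>(r # h) = r\<^sub>(\<^sub>-\<^sub>1\<^sub>) h \<otimes> r\<^sub>(\<^sub>0\<^sub>)\<close>, the tensor product \<open>\<sigma>\<close> of the
  antipodes, and \<open>\<mu>(g \<otimes> r) = (1 # g) (r # 1)\<close>. Each has a left inverse, those of \<open>\<theta>\<close> and \<open>\<mu>\<close>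
  involving the inverse of the antipode of \<open>H\<close>. In finite dimension a left inverse suffices.
\<close>

lemma bij_SA: "bij SA"
proof -
  define T where "T = inv S"
  have lin_T [lin_intros]: "lin f \<Longrightarrow> lin (\<lambda>x. T (f x))" for f :: "'k ^ 'h \<Rightarrow> _"
    unfolding T_def by (rule H.lin_inv_antipode)
  define \<theta> where "\<theta> x = sw x (\<lambda>r h. sw (\<delta> r) (\<lambda>g r0. (g \<cdot> h) \<otimes> r0))" for x
  define \<theta>' where "\<theta>' y = sw y (\<lambda>g r. sw (\<delta> r) (\<lambda>k r0. r0 \<otimes> (T k \<cdot> g)))" for y
  define \<mu> where "\<mu> y = sw y (\<lambda>g r. (\<one>\<^sub>R \<otimes> g) \<star> (r \<otimes> \<one>))" for y
  define \<mu>' where "\<mu>' x = sw x (\<lambda>r h. sw (\<Delta> h) (\<lambda>a b. b \<otimes> (T a \<rhd> r)))" for x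
  define \<sigma> where "\<sigma> = tmap S SR"
  define \<sigma>' where "\<sigma>' = tmap T (inv SR)"
  have lins: "lin \<theta>" "lin \<theta>'" "lin \<mu>" "lin \<mu>'" "lin \<sigma>" "lin \<sigma>'"
    unfolding \<theta>_def \<theta>'_def \<mu>_def \<mu>'_def \<sigma>_def \<sigma>'_def by (intro lin_intros)+
  have "\<theta>' (\<theta> (r \<otimes> h)) = r \<otimes> h" for r h
  proof -
    have "\<theta>' (\<theta> (r \<otimes> h)) = sw (\<delta> r) (\<lambda>g r0. sw (\<delta> r0) (\<lambda>k r00. r00 \<otimes> ((T k \<cdot> g) \<cdot> h)))"
      unfolding \<theta>'_def \<theta>_def by (simp add: sweedler lin_intros H.assoc)
    also have "\<dots> = sw (\<delta> r) (\<lambda>q r0. sw (\<Delta> q) (\<lambda>g k. r0 \<otimes> ((T k \<cdot> g) \<cdot> h)))"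
      by (rule coact_coassoc[symmetric]) (intro lin_intros)+
    also have "\<dots> = sw (\<delta> r) (\<lambda>q r0. \<epsilon> q *s (r0 \<otimes> h))"
      unfolding T_def by (rule sw_cong, subst H.inv_antipode_left_lin[of "\<lambda>x. _ \<otimes> (x \<cdot> h)"]) (simp_all add: lin_intros)
    also have "\<dots> = r \<otimes> h"
      by (rule counit_coact) (intro lin_intros)
    finally show ?thesis .
  qed
  then have \<theta>: "\<theta>' (\<theta> x) = x" for x
    by (rule lin_eqI[OF _ lin_id, where t=x, rotated]) (rule lin_comp[OF lins(2) lins(1)])
  have "\<mu>' (\<mu> (g \<otimes> r)) = g \<otimes> r" for g r
  proof -
    have "\<mu>' (\<mu> (g \<otimes> r)) = sw (\<Delta> g) (\<lambda>a x. sw (\<Delta> x) (\<lambda>c d. d \<otimes> ((T c \<cdot> a) \<rhd> r)))"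
      unfolding \<mu>'_def \<mu>_def by (simp add: sweedler lin_intros multA_tensor act_act)
    also have "\<dots> = sw (\<Delta> g) (\<lambda>x d. sw (\<Delta> x) (\<lambda>a c. d \<otimes> ((T c \<cdot> a) \<rhd> r)))"
      by (rule H.coassoc[symmetric]) (intro lin_intros)+
    also have "\<dots> = sw (\<Delta> g) (\<lambda>x d. \<epsilon> x *s (d \<otimes> r))"
      unfolding T_def by (rule sw_cong, subst H.inv_antipode_left_lin[of "\<lambda>x. _ \<otimes> (x \<rhd> r)"]) (simp_all add: lin_intros)
    also have "\<dots> = g \<otimes> r"
      by (rule H.counit_left) (intro lin_intros)
    finally show ?thesis .
  qed
  then have \<mu>: "\<mu>' (\<mu> x) = x" for x
    by (rule lin_eqI[OF _ lin_id, where t=x, rotated]) (rule lin_comp[OF lins(4) lins(3)])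
  have "\<sigma>' (\<sigma> (g \<otimes> r)) = g \<otimes> r" for g r
    unfolding \<sigma>_def \<sigma>'_def T_def using H.bij_antipode SR(2)
    by (simp add: tmap_tensor lin_intros bij_is_inj)
  then have \<sigma>: "\<sigma>' (\<sigma> x) = x" for x
    by (rule lin_eqI[OF _ lin_id, where t=x, rotated]) (rule lin_comp[OF lins(6) lins(5)])
  have "SA (r \<otimes> h) = \<mu> (\<sigma> (\<theta> (r \<otimes> h)))" for r h
    unfolding \<theta>_def \<mu>_def \<sigma>_def tmap_def by (simp add: sweedler lin_intros SA_tensor)
  then have SA: "SA x = \<mu> (\<sigma> (\<theta> x))" for x
    by (rule lin_eqI[where t=x, rotated 2]) (rule lin_SA[OF lin_id], rule lin_comp[OF lins(3) lin_comp[OF lins(5) lins(1)]])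
  define P where "P x = \<theta>' (\<sigma>' (\<mu>' x))" for x
  have "P \<circ> SA = id"
    by (simp add: fun_eq_iff P_def SA \<theta> \<mu> \<sigma>)
  moreover have "lin SA" by (rule lin_SA[OF lin_id])
  moreover have "lin P"
    unfolding P_def by (rule lin_comp[OF lins(2) lin_comp[OF lins(6) lins(4)]])
  ultimately have "SA \<circ> P = id"
    by (simp add: vec.linear_inverse_left)
  with \<open>P \<circ> SA = id\<close> show ?thesis
    by (metis o_bij)
qed

lemma hopf_A: "hopf_algebra A"
  unfolding hopf_algebra_def bialgebra_iff using is_antipode_SA bij_SA A.bialg_axioms by blast

section \<open>Twists from braided twists\<close>

text \<open>
  A coinvariant \<open>J\<close> does not contribute to the coaction of a product \<open>J T\<close>, so multiplication
  with it commutes with splitting off that coaction.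
\<close>

lemma leg23_iota3_right:
  assumes "coact2 H R J = \<one> \<otimes> J"
  shows "A.leg23 (\<iota> J) \<star>\<^sub>3 iota3_right r T = iota3_right r (J \<bullet>\<^sub>2 T)"
  unfolding iota3_right_def coact2_multRR assms A.leg23_def
  by (simp add: sweedler lin_intros iota_mult)

lemma leg12_iota3_left: "A.leg12 (\<iota> J) \<star>\<^sub>3 iota3_left T s = iota3_left (J \<bullet>\<^sub>2 T) s"
  unfolding iota3_left_def A.leg12_def
  by (simp add: tensor_mul_sw_right A.tassoc_mult iota_mult A2.assoc)

text \<open>
  The last condition on a braided twist, written with the product of \<open>R \<otimes> R\<close>.
\<close>

lemma braided_cocycle:
  assumes J: "braided_twist H R J"
  shows "sw J (\<lambda>a b. a \<otimes> (J \<bullet>\<^sub>2 \<Delta>\<^sub>R b)) = sw J (\<lambda>a b. tassoc ((J \<bullet>\<^sub>2 \<Delta>\<^sub>R a) \<otimes> b))"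
proof -
  have "J \<bullet>\<^sub>2 t = sw J (\<lambda>I1 I2. sw (\<delta> I2) (\<lambda>g I20. sw t (\<lambda>x y. (I1 \<bullet> (g \<rhd> x)) \<otimes> (I20 \<bullet> y))))" for t
    unfolding braided_mul_def by (rule sw_cong, rule sw_commute)
  then show ?thesis
    using J by (simp add: braided_twist_def sweedler)
qed

end

locale yd_twist = yd H S R for H :: "(('k::field), 'h::finite) bialg" and S and R :: "('k, 'h, 'r::finite) yd_bialg" +
  fixes J I
  assumes J: "braided_twist H R J"
    and JI: "J \<bullet>\<^sub>2 I = \<one>\<^sub>R \<otimes> \<one>\<^sub>R" and IJ: "I \<bullet>\<^sub>2 J = \<one>\<^sub>R \<otimes> \<one>\<^sub>R"
begin

lemma iota_JI: "\<iota> J \<star>\<^sub>2 \<iota> I = \<one>\<^sub>A \<otimes> \<one>\<^sub>A" "\<iota> I \<star>\<^sub>2 \<iota> J = \<one>\<^sub>A \<otimes> \<one>\<^sub>A"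
  by (simp_all add: JI IJ flip: iota_mult)

text \<open>
  The two sides of the cocycle condition for \<open>\<iota> J\<close> are the images under \<open>iota3\<close> of the two sides of
  the braided cocycle condition.
\<close>

lemma twist_iota: "twist A (\<iota> J)"
proof -
  have "A.leg23 (\<iota> J) \<star>\<^sub>3 A.comul_snd (\<iota> J) = sw J (\<lambda>a b. iota3 (a \<otimes> (J \<bullet>\<^sub>2 \<Delta>\<^sub>R b)))"
    unfolding comul_snd_iota using J
    by (simp add: tmap_def lin_sw_apply[OF lin_iota3(5)[OF lin_id]] iota3_tensor tensor_mul_sw_right leg23_iota3_right
        braided_twist_def)
  also have "\<dots> = iota3 (sw J (\<lambda>a b. a \<otimes> (J \<bullet>\<^sub>2 \<Delta>\<^sub>R b)))"
    by (simp add: lin_sw_apply[OF lin_iota3(5)[OF lin_id]])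
  also have "\<dots> = sw J (\<lambda>a b. iota3 (tassoc ((J \<bullet>\<^sub>2 \<Delta>\<^sub>R a) \<otimes> b)))"
    unfolding braided_cocycle[OF J] by (simp add: lin_sw_apply[OF lin_iota3(5)[OF lin_id]])
  also have "\<dots> = A.leg12 (\<iota> J) \<star>\<^sub>3 A.comul_fst (\<iota> J)"
    unfolding comul_fst_iota
    by (simp add: tmap_def tassoc_sw lin_sw_apply[OF lin_iota3(5)[OF lin_id]] iota3_tassoc tensor_mul_sw_right leg12_iota3_left)
  finally have "A.cocycle (\<iota> J)"
    unfolding A.cocycle_def .
  moreover have "A.counit_snd (\<iota> J) = \<one>\<^sub>A" "A.counit_fst (\<iota> J) = \<one>\<^sub>A"
    using J by (simp_all add: counit_fst_iota counit_snd_iota unitA braided_twist_def)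
  ultimately show ?thesis
    unfolding A.twist_iff using iota_JI by blast
qed

text \<open>
  Invariance of \<open>J\<close> turns the commutation rule \<open>emb_iota\<close> into genuine commutation.
\<close>

lemma emb_commute: "emb (\<Delta> h) \<star>\<^sub>2 \<iota> J = \<iota> J \<star>\<^sub>2 emb (\<Delta> h)" "emb (\<Delta> h) \<star>\<^sub>2 \<iota> I = \<iota> I \<star>\<^sub>2 emb (\<Delta> h)"
proof -
  have "\<iota> (act2 H R g J) = \<epsilon> g *s \<iota> J" for g
    using J lin_scale_apply[OF lin_iota[OF lin_id]] by (simp add: braided_twist_def)
  then show 1: "emb (\<Delta> h) \<star>\<^sub>2 \<iota> J = \<iota> J \<star>\<^sub>2 emb (\<Delta> h)"
    by (simp add: emb_iota A2.mult_scale_left H.counit_left lin_intros)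
  have "emb (\<Delta> h) \<star>\<^sub>2 \<iota> I = \<iota> I \<star>\<^sub>2 (\<iota> J \<star>\<^sub>2 emb (\<Delta> h)) \<star>\<^sub>2 \<iota> I"
    by (simp add: A2.cancel_left[OF iota_JI(2)] A2.assoc)
  also have "\<dots> = \<iota> I \<star>\<^sub>2 emb (\<Delta> h)"
    unfolding 1[symmetric] by (simp add: A2.assoc iota_JI)
  finally show "emb (\<Delta> h) \<star>\<^sub>2 \<iota> I = \<iota> I \<star>\<^sub>2 emb (\<Delta> h)" .
qed

sublocale AJ: twisted_bialg "bosonization H R" "\<iota> J" "\<iota> I"
  using twist_iota iota_JI by unfold_locales

lemma comul_braided_twisted: "comul (braided_twisted R J) r = (J \<bullet>\<^sub>2 \<Delta>\<^sub>R r) \<bullet>\<^sub>2 I"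
  using RR.inverse_in_eq[OF JI IJ] by (simp add: braided_twisted_def)

text \<open>
  The two Hopf algebras have the same underlying algebra, and their coproducts coincide: \<open>\<iota>\<close> is
  multiplicative, so \<open>\<iota>(J \<Delta>(r) I) \<Delta>(h) = \<iota>(J) \<iota>(\<Delta>(r)) \<iota>(I) \<Delta>(h)\<close>, and \<open>\<iota>(I)\<close> commutes with \<open>\<Delta>(h)\<close>.
\<close>

lemma bosonization_braided_twisted: "bosonization H (braided_twisted R J) = twisted A (\<iota> J)"
proof (rule bialg.equality)
  have mul: "mul (braided_twisted R J) = mul R" "unit_el (braided_twisted R J) = \<one>\<^sub>R"
    "act (braided_twisted R J) = act R" "coact (braided_twisted R J) = \<delta>" "counit (braided_twisted R J) = \<epsilon>\<^sub>R"
    by (simp_all add: braided_twisted_def)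
  show "mul (bosonization H (braided_twisted R J)) = mul AJ.KJ"
    "unit_el (bosonization H (braided_twisted R J)) = unit_el AJ.KJ"
    "counit (bosonization H (braided_twisted R J)) = counit AJ.KJ"
    unfolding AJ.twisted_simps by (simp_all add: bosonization_def mul)
  show "comul (bosonization H (braided_twisted R J)) = comul AJ.KJ"
  proof
    fix x
    have eq: "comul (bosonization H (braided_twisted R J)) x =
      sw x (\<lambda>r h. \<iota> ((J \<bullet>\<^sub>2 \<Delta>\<^sub>R r) \<bullet>\<^sub>2 I) \<star>\<^sub>2 emb (\<Delta> h))" for x
      unfolding iota_emb[symmetric] comul_braided_twisted[symmetric] by (simp add: bosonization_def mul)
    show "comul (bosonization H (braided_twisted R J)) x = comul AJ.KJ x"
      unfolding eq
    proof (rule lin_eqI[where t=x])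
      fix r h
      show "sw (r \<otimes> h) (\<lambda>r h. \<iota> ((J \<bullet>\<^sub>2 \<Delta>\<^sub>R r) \<bullet>\<^sub>2 I) \<star>\<^sub>2 emb (\<Delta> h)) = comul AJ.KJ (r \<otimes> h)"
        by (simp add: sweedler lin_intros AJ.comul_twisted comulA_tensor iota_mult A2.assoc emb_commute)
    qed (intro lin_intros AJ.lin_comul_twisted)+
  qed
qed simp_all

text \<open>
  By \<open>emb_commute\<close> the coproduct of \<open>1 # h\<close> is not changed by the twist \<open>\<iota> J\<close>. Hence
  \<open>h \<mapsto> 1 # h\<close> is a bialgebra homomorphism into the twisted bosonization and transports twists.
\<close>

lemma twist_emb:
  assumes "twist H F"
  shows "twist (twisted A (\<iota> J)) (emb F)"
  unfolding embed2_def
proof (rule twist_transport)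
  show "comul AJ.KJ (\<one>\<^sub>R \<otimes> h) = tmap (\<lambda>h. \<one>\<^sub>R \<otimes> h) (\<lambda>h. \<one>\<^sub>R \<otimes> h) (\<Delta> h)" for h
    unfolding embed2_def[symmetric] AJ.comul_twisted comulA_H emb_commute[symmetric]
    by (simp add: A2.assoc iota_JI)
qed (use assms H.bialg_axioms AJ.bialg_twisted in
  \<open>simp_all add: lin_intros multA_oneR unitA counitA_tensor\<close>)

lemma bos_twist_by_eq: "bos_twist_by H R J F = emb F \<star>\<^sub>2 \<iota> J"
  by (simp add: bos_twist_by_def Let_def)

lemma bos_twist_by_explicit: "bos_twist_by H R J F =
         sw F (\<lambda>F1 F2. sw J (\<lambda>J1 J2. sw (coact R J2) (\<lambda>g J20.
           sw (comul H F1) (\<lambda>F11 F12. sw (comul H F2) (\<lambda>F21 F22.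
             (act R F11 J1 \<otimes> mul H F12 g) \<otimes> (act R F21 J20 \<otimes> F22))))))"
  unfolding bos_twist_by_eq
proof (rule bilin_eqI[where s=F and t=J])
  fix a b c d
  show "emb (a \<otimes> b) \<star>\<^sub>2 \<iota> (c \<otimes> d) = sw (a \<otimes> b) (\<lambda>F1 F2. sw (c \<otimes> d) (\<lambda>J1 J2. sw (coact R J2) (\<lambda>g J20.
           sw (comul H F1) (\<lambda>F11 F12. sw (comul H F2) (\<lambda>F21 F22.
             (act R F11 J1 \<otimes> mul H F12 g) \<otimes> (act R F21 J20 \<otimes> F22))))))"
    by (simp add: iota_tensor multA_tensor sweedler lin_intros) (rule sw_cong, rule sw_commute)
qed (intro lin_intros)+

end

lemma hopf_iso_refl: "hopf_algebra K \<Longrightarrow> hopf_iso K K"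
  unfolding hopf_iso_def
  by (intro conjI exI[of _ id]) (simp_all add: vec.linear_id tmap_def sw_eq_self)

theorem proposition3p15:
  fixes H :: "('k::{alg_closed_field, field_char_0}, 'h::finite) bialg"
    and R :: "('k, 'h, 'r::finite) yd_bialg"
    and A :: "('k, 'r \<times> 'h) bialg"
    and J :: "'k ^ ('r \<times> 'r)"
  assumes H: "hopf_algebra H"
    and R: "yd_hopf_algebra H R"
    and A: "A = bosonization H R"
    and J: "braided_twist H R J"
  shows "twist A (bos_twist H R J) \<and>
    hopf_iso (bosonization H (braided_twisted R J)) (twisted A (bos_twist H R J)) \<and>
    (\<forall>F :: 'k ^ ('h \<times> 'h). twist H F \<longrightarrow>
       bos_twist_by H R J F =
         sw F (\<lambda>F1 F2. sw J (\<lambda>J1 J2. sw (coact R J2) (\<lambda>g J20.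
           sw (comul H F1) (\<lambda>F11 F12. sw (comul H F2) (\<lambda>F21 F22.
             (act R F11 J1 \<otimes> mul H F12 g) \<otimes> (act R F21 J20 \<otimes> F22)))))) \<and>
       twist A (bos_twist_by H R J F) \<and>
       hopf_iso (twisted (bosonization H (braided_twisted R J)) (embed2 R F))
         (twisted A (bos_twist_by H R J F)))"
proof -
  obtain S where "hopf H S"
    using H by (auto simp: hopf_algebra_iff)
  then interpret yd H S R
    using R by (simp add: yd_def yd_axioms_def)
  obtain I where "J \<bullet>\<^sub>2 I = \<one>\<^sub>R \<otimes> \<one>\<^sub>R" "I \<bullet>\<^sub>2 J = \<one>\<^sub>R \<otimes> \<one>\<^sub>R"
    using J by (auto simp: braided_twist_def invertible_in_def)
  then interpret yd_twist H S R J I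
    using J by unfold_locales
  have F: "twist (bosonization H R) (bos_twist_by H R J F)"
    "twisted (bosonization H (braided_twisted R J)) (embed2 R F) = twisted (bosonization H R) (bos_twist_by H R J F)"
    if "twist H F" for F
    using AJ.twist_compose[OF twist_emb[OF that]]
    by (simp_all add: bos_twist_by_eq bosonization_braided_twisted)
  show ?thesis
    unfolding A
    using twist_iota F hopf_A bos_twist_by_explicit
    by (auto simp: bosonization_braided_twisted intro!: hopf_iso_refl hopf_algebra_twisted)
qed

end
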